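(* Let $G=G_+G_-$ be a unique factorization of a finite group $G$. (i) An element $R\in H(G;G_+,G_-)\otimes H(G;G_+,G_-)$ is a positive triangular structure if and only if \[ R=\sum_{u,v\in G_+}\{u(\xi(v)^{u})^{-1}\}\otimes\{v\,\xi(u)\} \] for a group homomorphism $\xi:G_+\to G_-$ such that $A_\xi=\{u\xi(u^{-1}):u\in G_+\}$ is an abelian normal subgroup of $G$; $\xi$ is uniquely determined by $R$. (ii) For a group homomorphism $\xi:G_+\to G_-$, $A_\xi$ is an abelian normal subgroup of $G$ if and only if $uv=({}^{\xi(u)}v)(u^{\xi(v)})$ and $\xi({}^x u)\,x^u=x\,\xi(u)$ for all $u,v\in G_+$, $x\in G_-$. (iii) Pairs $(G=G_+G_-,\xi)$ as in (ii) correspond one-to-one to triples $(G_-,A,\zeta)$ consisting of a finite group $G_-$, a finite abelian group $A$ on which $G_-$ acts by automorphisms, and a 1-cycle $\zeta:A\to G_-$: given $(G=G_+G_-,\xi)$ take $A=A_\xi$ with $G_-$ acting by conjugation and $\zeta(u\xi(u^{-1}))=\xi(u)$; given $(G_-,A,\zeta)$ take $G=A\rtimes G_-$, $G_+=\{a\zeta(a):a\in A\}$, and $\xi=P|_{G_+}$ where $P:A\rtimes G_-\to G_-$, $ax\mapsto x$. These constructions are well defined and mutually inverse (identifying $G$ with $A_\xi\rtimes G_-$ via $(a,x)\mapsto ax$).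
   Context: A unique factorization $G=G_+G_-$ consists of subgroups $G_+,G_-$ with every $g\in G$ uniquely $g=g_+g_-$, $g_+\in G_+$, $g_-\in G_-$. For $u\in G_+$, $x\in G_-$ define ${}^u x\in G_-$, $u^x\in G_+$, ${}^x u\in G_+$, $x^u\in G_-$ by $ux=({}^u x)(u^x)$ and $xu=({}^x u)(x^u)$. $H(G;G_+,G_-)$ is the complex vector space with basis $\{g\}$, $g\in G$, and Hopf algebra structure $\{g\}\{h\}=\delta_{g_+^{\,g_-},\,h_+}\{g h_-\}$, $1=\sum_{u\in G_+}\{u\}$, $\Delta\{g\}=\sum_{h\in G_+}\{g_+h^{-1}({}^{h}g_-)\}\otimes\{h g_-\}$, $\varepsilon\{g\}=\delta_{g_+,e}$, $S\{g\}=\{g^{-1}\}$. A quasi-triangular structure on a Hopf algebra $H$ is an invertible $R\in H\otimes H$ with $\tau\Delta(a)=R\Delta(a)R^{-1}$ for all $a$ ($\tau$ the flip), $(\Delta\otimes\mathrm{id})R=R_{13}R_{23}$, $(\mathrm{id}\otimes\Delta)R=R_{13}R_{12}$, $(\varepsilon\otimes\mathrm{id})R=(\mathrm{id}\otimes\varepsilon)R=1$; it is triangular if moreover $(\tau R)R=1\otimes1$. It is positive if it is a linear combination of the $\{g\}\otimes\{h\}$ with non-negative real coefficients. If $G_-$ acts on $A$ by automorphisms $(x,a)\mapsto x\cdot a$, then $A\rtimes G_-$ has product $(ax)(by)=a(x\cdot b)xy$, and $\zeta:A\to G_-$ is a 1-cycle if $\zeta(a)\zeta(b)=\zeta(a(\zeta(a)\cdot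 b))$ for all $a,b\in A$. (The paper phrases item (i) as data "a finite dimensional Hopf algebra with a positive basis and a positive triangular structure"; such Hopf algebras are, by the authors' earlier work, of the form $H(G;G_+,G_-)$ with basis $G$.) *)

theory Defs
  imports "HOL-Algebra.Algebra" Complex_Main
begin

definition ufact :: "'g monoid \<Rightarrow> 'g set \<Rightarrow> 'g set \<Rightarrow> bool" where
  "ufact G Gp Gm \<longleftrightarrow> subgroup Gp G \<and> subgroup Gm G \<and>
     (\<forall>g\<in>carrier G. \<exists>!p. p \<in> Gp \<times> Gm \<and> g = fst p \<otimes>\<^bsub>G\<^esub> snd p)"

definition factor :: "'g monoid \<Rightarrow> 'g set \<Rightarrow> 'g set \<Rightarrow> 'g \<Rightarrow> 'g \<times> 'g" where
  "factor G H K g = (THE p. p \<in> H \<times> K \<and> g = fst p \<otimes>\<^bsub>G\<^esub> snd p)"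

definition ufp :: "'g monoid \<Rightarrow> 'g set \<Rightarrow> 'g set \<Rightarrow> 'g \<Rightarrow> 'g" where
  "ufp G Gp Gm g = fst (factor G Gp Gm g)"
definition ufm :: "'g monoid \<Rightarrow> 'g set \<Rightarrow> 'g set \<Rightarrow> 'g \<Rightarrow> 'g" where
  "ufm G Gp Gm g = snd (factor G Gp Gm g)"

text \<open>For u in G+, x in G-: u x = (lact_m u x)(ract_p u x), i.e. lact_m u x = {}^u x, ract_p u x = u^x;
  x u = (lact_p x u)(ract_m x u), i.e. lact_p x u = {}^x u, ract_m x u = x^u.\<close>
definition lact_m :: "'g monoid \<Rightarrow> 'g set \<Rightarrow> 'g set \<Rightarrow> 'g \<Rightarrow> 'g \<Rightarrow> 'g" where
  "lact_m G Gp Gm u x = fst (factor G Gm Gp (u \<otimes>\<^bsub>G\<^esub> x))"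
definition ract_p :: "'g monoid \<Rightarrow> 'g set \<Rightarrow> 'g set \<Rightarrow> 'g \<Rightarrow> 'g \<Rightarrow> 'g" where
  "ract_p G Gp Gm u x = snd (factor G Gm Gp (u \<otimes>\<^bsub>G\<^esub> x))"
definition lact_p :: "'g monoid \<Rightarrow> 'g set \<Rightarrow> 'g set \<Rightarrow> 'g \<Rightarrow> 'g \<Rightarrow> 'g" where
  "lact_p G Gp Gm x u = fst (factor G Gp Gm (x \<otimes>\<^bsub>G\<^esub> u))"
definition ract_m :: "'g monoid \<Rightarrow> 'g set \<Rightarrow> 'g set \<Rightarrow> 'g \<Rightarrow> 'g \<Rightarrow> 'g" where
  "ract_m G Gp Gm x u = snd (factor G Gp Gm (x \<otimes>\<^bsub>G\<^esub> u))"

text \<open>Elements of H, H\<otimes>H, H\<otimes>H\<otimes>H are coefficient functions on the basis G, G\<times>G, G\<times>G\<times>G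
  (vanishing outside the basis).\<close>
definition H1 :: "'g monoid \<Rightarrow> ('g \<Rightarrow> complex) set" where
  "H1 G = {f. \<forall>g. g \<notin> carrier G \<longrightarrow> f g = 0}"
definition H2 :: "'g monoid \<Rightarrow> ('g \<times> 'g \<Rightarrow> complex) set" where
  "H2 G = {f. \<forall>p. p \<notin> carrier G \<times> carrier G \<longrightarrow> f p = 0}"

text \<open>Product of basis elements: {g}{h} = delta_{g_+^{g_-}, h_+} {g h_-}  (None = zero).\<close>
definition bprod :: "'g monoid \<Rightarrow> 'g set \<Rightarrow> 'g set \<Rightarrow> 'g \<Rightarrow> 'g \<Rightarrow> 'g option" where
  "bprod G Gp Gm g h =
     (if ract_p G Gp Gm (ufp G Gp Gm g) (ufm G Gp Gm g) = ufp G Gp Gm h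
      then Some (g \<otimes>\<^bsub>G\<^esub> ufm G Gp Gm h) else None)"

definition hmul2 :: "'g monoid \<Rightarrow> 'g set \<Rightarrow> 'g set \<Rightarrow> ('g \<times> 'g \<Rightarrow> complex) \<Rightarrow> ('g \<times> 'g \<Rightarrow> complex) \<Rightarrow> 'g \<times> 'g \<Rightarrow> complex" where
  "hmul2 G Gp Gm F1 F2 = (\<lambda>(k1, k2).
     \<Sum>(g1, g2)\<in>carrier G \<times> carrier G. \<Sum>(h1, h2)\<in>carrier G \<times> carrier G.
       if bprod G Gp Gm g1 h1 = Some k1 \<and> bprod G Gp Gm g2 h2 = Some k2
       then F1 (g1, g2) * F2 (h1, h2) else 0)"

definition hmul3 :: "'g monoid \<Rightarrow> 'g set \<Rightarrow> 'g set \<Rightarrow> ('g \<times> 'g \<times> 'g \<Rightarrow> complex) \<Rightarrow> ('g \<times> 'g \<times> 'g \<Rightarrow> complex) \<Rightarrow> 'g \<times> 'g \<times> 'g \<Rightarrow> complex" where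
  "hmul3 G Gp Gm F1 F2 = (\<lambda>(k1, k2, k3).
     \<Sum>(g1, g2, g3)\<in>carrier G \<times> carrier G \<times> carrier G. \<Sum>(h1, h2, h3)\<in>carrier G \<times> carrier G \<times> carrier G.
       if bprod G Gp Gm g1 h1 = Some k1 \<and> bprod G Gp Gm g2 h2 = Some k2 \<and> bprod G Gp Gm g3 h3 = Some k3
       then F1 (g1, g2, g3) * F2 (h1, h2, h3) else 0)"

definition hunit :: "'g set \<Rightarrow> 'g \<Rightarrow> complex" where
  "hunit Gp k = (if k \<in> Gp then 1 else 0)"
definition hunit2 :: "'g set \<Rightarrow> 'g \<times> 'g \<Rightarrow> complex" where
  "hunit2 Gp = (\<lambda>(k1, k2). hunit Gp k1 * hunit Gp k2)"

definition hcomul :: "'g monoid \<Rightarrow> 'g set \<Rightarrow> 'g set \<Rightarrow> ('g \<Rightarrow> complex) \<Rightarrow> 'g \<times> 'g \<Rightarrow> complex" where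
  "hcomul G Gp Gm f = (\<lambda>(k1, k2).
     \<Sum>g\<in>carrier G. \<Sum>h\<in>Gp.
       if k1 = ufp G Gp Gm g \<otimes>\<^bsub>G\<^esub> inv\<^bsub>G\<^esub> h \<otimes>\<^bsub>G\<^esub> lact_m G Gp Gm h (ufm G Gp Gm g)
          \<and> k2 = h \<otimes>\<^bsub>G\<^esub> ufm G Gp Gm g
       then f g else 0)"

definition hcounit :: "'g monoid \<Rightarrow> 'g set \<Rightarrow> 'g set \<Rightarrow> 'g \<Rightarrow> complex" where
  "hcounit G Gp Gm g = (if ufp G Gp Gm g = \<one>\<^bsub>G\<^esub> then 1 else 0)"

text \<open>Antipode S{g} = {g^-1} (part of the Hopf structure; not needed for the notions below).\<close>
definition hantipode :: "'g monoid \<Rightarrow> ('g \<Rightarrow> complex) \<Rightarrow> 'g \<Rightarrow> complex" where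
  "hantipode G f = (\<lambda>k. if k \<in> carrier G then f (inv\<^bsub>G\<^esub> k) else 0)"

definition quasitriangular :: "'g monoid \<Rightarrow> 'g set \<Rightarrow> 'g set \<Rightarrow> ('g \<times> 'g \<Rightarrow> complex) \<Rightarrow> bool" where
  "quasitriangular G Gp Gm R \<longleftrightarrow>
     R \<in> H2 G \<and>
     (\<exists>Rinv\<in>H2 G. hmul2 G Gp Gm R Rinv = hunit2 Gp \<and> hmul2 G Gp Gm Rinv R = hunit2 Gp \<and>
        (\<forall>a\<in>H1 G. (\<lambda>(k1, k2). hcomul G Gp Gm a (k2, k1))
                    = hmul2 G Gp Gm (hmul2 G Gp Gm R (hcomul G Gp Gm a)) Rinv)) \<and>
     (\<lambda>(k1, k2, k3). hcomul G Gp Gm (\<lambda>g. R (g, k3)) (k1, k2))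
        = hmul3 G Gp Gm (\<lambda>(k1, k2, k3). R (k1, k3) * hunit Gp k2)
                        (\<lambda>(k1, k2, k3). hunit Gp k1 * R (k2, k3)) \<and>
     (\<lambda>(k1, k2, k3). hcomul G Gp Gm (\<lambda>g. R (k1, g)) (k2, k3))
        = hmul3 G Gp Gm (\<lambda>(k1, k2, k3). R (k1, k3) * hunit Gp k2)
                        (\<lambda>(k1, k2, k3). R (k1, k2) * hunit Gp k3) \<and>
     (\<forall>h. (\<Sum>g\<in>carrier G. hcounit G Gp Gm g * R (g, h)) = hunit Gp h) \<and>
     (\<forall>g. (\<Sum>h\<in>carrier G. hcounit G Gp Gm h * R (g, h)) = hunit Gp g)"

definition triangular :: "'g monoid \<Rightarrow> 'g set \<Rightarrow> 'g set \<Rightarrow> ('g \<times> 'g \<Rightarrow> complex) \<Rightarrow> bool" where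
  "triangular G Gp Gm R \<longleftrightarrow> quasitriangular G Gp Gm R \<and>
     hmul2 G Gp Gm (\<lambda>(k1, k2). R (k2, k1)) R = hunit2 Gp"

definition positive :: "('g \<times> 'g \<Rightarrow> complex) \<Rightarrow> bool" where
  "positive R \<longleftrightarrow> (\<forall>p. Im (R p) = 0 \<and> 0 \<le> Re (R p))"

definition Rxi :: "'g monoid \<Rightarrow> 'g set \<Rightarrow> 'g set \<Rightarrow> ('g \<Rightarrow> 'g) \<Rightarrow> 'g \<times> 'g \<Rightarrow> complex" where
  "Rxi G Gp Gm \<xi> = (\<lambda>(k1, k2). \<Sum>u\<in>Gp. \<Sum>v\<in>Gp.
     if k1 = u \<otimes>\<^bsub>G\<^esub> inv\<^bsub>G\<^esub> (ract_m G Gp Gm (\<xi> v) u) \<and> k2 = v \<otimes>\<^bsub>G\<^esub> \<xi> u then 1 else 0)"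

definition Axi :: "'g monoid \<Rightarrow> 'g set \<Rightarrow> ('g \<Rightarrow> 'g) \<Rightarrow> 'g set" where
  "Axi G Gp \<xi> = (\<lambda>u. u \<otimes>\<^bsub>G\<^esub> \<xi> (inv\<^bsub>G\<^esub> u)) ` Gp"

definition act_by_aut :: "'x monoid \<Rightarrow> 'a monoid \<Rightarrow> ('x \<Rightarrow> 'a \<Rightarrow> 'a) \<Rightarrow> bool" where
  "act_by_aut Gm A \<phi> \<longleftrightarrow>
     (\<forall>x\<in>carrier Gm. \<phi> x \<in> hom A A \<and> bij_betw (\<phi> x) (carrier A) (carrier A)) \<and>
     (\<forall>a\<in>carrier A. \<phi> \<one>\<^bsub>Gm\<^esub> a = a) \<and>
     (\<forall>x\<in>carrier Gm. \<forall>y\<in>carrier Gm. \<forall>a\<in>carrier A. \<phi> (x \<otimes>\<^bsub>Gm\<^esub> y) a = \<phi> x (\<phi> y a))"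

definition one_cycle :: "'x monoid \<Rightarrow> 'a monoid \<Rightarrow> ('x \<Rightarrow> 'a \<Rightarrow> 'a) \<Rightarrow> ('a \<Rightarrow> 'x) \<Rightarrow> bool" where
  "one_cycle Gm A \<phi> \<zeta> \<longleftrightarrow> \<zeta> \<in> carrier A \<rightarrow> carrier Gm \<and>
     (\<forall>a\<in>carrier A. \<forall>b\<in>carrier A. \<zeta> a \<otimes>\<^bsub>Gm\<^esub> \<zeta> b = \<zeta> (a \<otimes>\<^bsub>A\<^esub> \<phi> (\<zeta> a) b))"

text \<open>A \<rtimes> G-, with (a,x) standing for ax: (ax)(by) = a (x.b) xy.\<close>
definition sdprod :: "'a monoid \<Rightarrow> 'x monoid \<Rightarrow> ('x \<Rightarrow> 'a \<Rightarrow> 'a) \<Rightarrow> ('a \<times> 'x) monoid" where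
  "sdprod A Gm \<phi> = \<lparr>carrier = carrier A \<times> carrier Gm,
     monoid.mult = (\<lambda>(a, x) (b, y). (a \<otimes>\<^bsub>A\<^esub> \<phi> x b, x \<otimes>\<^bsub>Gm\<^esub> y)),
     monoid.one = (\<one>\<^bsub>A\<^esub>, \<one>\<^bsub>Gm\<^esub>)\<rparr>"

definition pt_act :: "'g monoid \<Rightarrow> 'g \<Rightarrow> 'g \<Rightarrow> 'g" where
  "pt_act G x a = x \<otimes>\<^bsub>G\<^esub> a \<otimes>\<^bsub>G\<^esub> inv\<^bsub>G\<^esub> x"
definition pt_zeta :: "'g monoid \<Rightarrow> 'g set \<Rightarrow> ('g \<Rightarrow> 'g) \<Rightarrow> 'g \<Rightarrow> 'g" where
  "pt_zeta G Gp \<xi> a = \<xi> (THE u. u \<in> Gp \<and> a = u \<otimes>\<^bsub>G\<^esub> \<xi> (inv\<^bsub>G\<^esub> u))"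

text \<open>Triple -> pair: G+ = {a zeta(a)}, G- embedded as {1 x}, xi = P restricted, P(ax) = x
  (with x regarded as the element 1x of A \<rtimes> G-).\<close>
definition tp_Gp :: "'a monoid \<Rightarrow> ('a \<Rightarrow> 'x) \<Rightarrow> ('a \<times> 'x) set" where
  "tp_Gp A \<zeta> = {(a, \<zeta> a) | a. a \<in> carrier A}"
definition tp_Gm :: "'a monoid \<Rightarrow> 'x monoid \<Rightarrow> ('a \<times> 'x) set" where
  "tp_Gm A Gm = {(\<one>\<^bsub>A\<^esub>, x) | x. x \<in> carrier Gm}"
definition tp_xi :: "'a monoid \<Rightarrow> 'a \<times> 'x \<Rightarrow> 'a \<times> 'x" where
  "tp_xi A p = (\<one>\<^bsub>A\<^esub>, snd p)"

end

theory Submission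
  imports Defs "HOL-Library.Complex_Order"
begin

text \<open>
  In the basis \<open>{u x}\<close> with \<open>u \<in> G\<^sub>+\<close>, \<open>x \<in> G\<^sub>-\<close>, the algebra \<open>H \<otimes> H\<close> is the convolution algebra of
  the action groupoid of \<open>G\<^sub>- \<times> G\<^sub>-\<close> on \<open>G\<^sub>+ \<times> G\<^sub>+\<close>. A triangular structure has inverse \<open>\<tau>R\<close>, so a
  positive one is a non-negative element with a non-negative inverse. This forces it to be monomial:
  \<open>R = \<Sum> c(u, v) {u a(u, v)} \<otimes> {v b(u, v)}\<close>. Comparing coefficients in \<open>(id \<otimes> \<Delta>)R = R\<^sub>1\<^sub>3R\<^sub>1\<^sub>2\<close> shows that
  \<open>b(u, v) = \<xi>(u)\<close> does not depend on \<open>v\<close>, those in \<open>(\<Delta> \<otimes> id)R = R\<^sub>1\<^sub>3R\<^sub>2\<^sub>3\<close> show that \<open>\<xi>\<close> is a homomorphism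
  and that \<open>c\<close> is a cocycle, and \<open>(\<tau>R)R = 1\<close> determines \<open>a\<close> from \<open>\<xi>\<close>. The relation \<open>\<tau>\<Delta> \<cdot> R = R \<cdot> \<Delta>\<close> yields
  the two identities of (ii) and the \<open>G\<^sub>-\<close>-invariance of \<open>c\<close>. Hence \<open>c(\<cdot>, v)\<close> is a positive
  character of a finite group, so \<open>c = 1\<close>. For (ii), \<open>q(u) = u \<xi>(u)\<^sup>-\<^sup>1\<close> satisfies
  \<open>x q(u) x\<^sup>-\<^sup>1 = q(\<^sup>xu)\<close> for \<open>x \<in> G\<^sub>-\<close> exactly when the second identity holds, and the first one then
  expresses that the elements \<open>q(u)\<close> commute.
\<close>

section \<open>Convolution over a finite group action\<close>

lemma (in group) inv_cancel_left:
  assumes "x \<in> carrier G" "y \<in> carrier G"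
  shows "x \<otimes> (inv x \<otimes> y) = y" "inv x \<otimes> (x \<otimes> y) = y"
  using assms by (simp_all add: m_assoc[symmetric])

lemma (in group) inv_mult_eq_iff:
  assumes "x \<in> carrier G" "y \<in> carrier G" "z \<in> carrier G"
  shows "inv x \<otimes> y = z \<longleftrightarrow> y = x \<otimes> z"
  using assms by (metis inv_cancel_left)

lemma (in group) inv_mult_eq_one_iff:
  assumes "x \<in> carrier G" "y \<in> carrier G"
  shows "inv x \<otimes> y = \<one> \<longleftrightarrow> y = x"
  using assms by (simp add: inv_mult_eq_iff)

locale finite_right_action = group K for K :: "'k monoid" (structure) +
  fixes U :: "'u set" and act :: "'u \<Rightarrow> 'k \<Rightarrow> 'u"
  assumes finite_K: "finite (carrier K)"
    and act_closed: "u \<in> U \<Longrightarrow> x \<in> carrier K \<Longrightarrow> act u x \<in> U"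
    and act_one: "u \<in> U \<Longrightarrow> act u \<one> = u"
    and act_mult: "u \<in> U \<Longrightarrow> x \<in> carrier K \<Longrightarrow> y \<in> carrier K \<Longrightarrow>
      act u (x \<otimes> y) = act (act u x) y"
begin

text \<open>This is groupoid convolution: \<open>E u x\<close> is the coefficient of the arrow
  labelled \<open>x\<close> from \<open>u\<close> to \<open>act u x\<close>, and the arrow labelled
  \<open>z\<close> factors as \<open>x\<close> followed by \<open>inv x \<otimes> z\<close>.\<close>

definition conv :: "('u \<Rightarrow> 'k \<Rightarrow> complex) \<Rightarrow> ('u \<Rightarrow> 'k \<Rightarrow> complex) \<Rightarrow> 'u \<Rightarrow> 'k \<Rightarrow> complex" where
  "conv E F u z = (\<Sum>x\<in>carrier K. E u x * F (act u x) (inv x \<otimes> z))"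

text \<open>Both sides sum over all ways to split an arrow into three; they differ in whether the
  second arrow is recorded by its own label or by the product of the first two labels.\<close>

lemma conv_assoc:
  assumes u: "u \<in> U" and z: "z \<in> carrier K"
  shows "conv (conv D E) F u z = conv D (conv E F) u z"
proof -
  have "conv (conv D E) F u z =
      (\<Sum>x\<in>carrier K. \<Sum>y\<in>carrier K. D u x * E (act u x) (inv x \<otimes> y) * F (act u y) (inv y \<otimes> z))"
    unfolding conv_def sum_distrib_right by (rule sum.swap)
  also have "\<dots> = (\<Sum>x\<in>carrier K. \<Sum>y\<in>carrier K.
      D u x * (E (act u x) y * F (act (act u x) y) (inv y \<otimes> (inv x \<otimes> z))))"
  proof (rule sum.cong[OF refl])
    fix x assume x: "x \<in> carrier K"
    show "(\<Sum>y\<in>carrier K. D u x * E (act u x) (inv x \<otimes> y) * F (act u y) (inv y \<otimes> z)) =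
      (\<Sum>y\<in>carrier K. D u x * (E (act u x) y * F (act (act u x) y) (inv y \<otimes> (inv x \<otimes> z))))"
      by (rule sum.reindex_bij_witness[where i = "\<lambda>y. x \<otimes> y" and j = "\<lambda>y. inv x \<otimes> y"])
        (use x u z in \<open>auto simp: inv_cancel_left inv_mult_group m_assoc act_mult[symmetric]\<close>)
  qed
  also have "\<dots> = conv D (conv E F) u z"
    unfolding conv_def sum_distrib_left ..
  finally show ?thesis .
qed

lemma conv_single:
  assumes "x \<in> carrier K" "\<And>y. y \<in> carrier K \<Longrightarrow> y \<noteq> x \<Longrightarrow> E u y = 0"
  shows "conv E F u z = E u x * F (act u x) (inv x \<otimes> z)"
  unfolding conv_def using assms finite_K
  by (subst sum.remove[of _ x]) (auto intro!: sum.neutral)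

lemma conv_unit_right:
  assumes u: "u \<in> U" and z: "z \<in> carrier K"
    and I: "\<And>v y. v \<in> U \<Longrightarrow> y \<in> carrier K \<Longrightarrow> I v y = (if y = \<one> then 1 else 0)"
  shows "conv E I u z = E u z"
proof -
  have "conv E I u z = (\<Sum>x\<in>carrier K. if x = z then E u x else 0)"
    unfolding conv_def
  proof (rule sum.cong[OF refl])
    fix x assume x: "x \<in> carrier K"
    then have "inv x \<otimes> z = \<one> \<longleftrightarrow> x = z"
      using z by (auto simp: inv_mult_eq_one_iff)
    then show "E u x * I (act u x) (inv x \<otimes> z) = (if x = z then E u x else 0)"
      using I[OF act_closed[OF u x]] x z by simp
  qed
  also have "\<dots> = E u z"
    using z finite_K by simp
  finally show ?thesis .
qed

text \<open>Since no cancellation can occur, every composable pair of arrows in the supports of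
  \<open>E\<close> and \<open>F\<close> composes to an identity arrow.\<close>
lemma nonneg_invertible_monomial:
  assumes nonneg: "\<And>u x. 0 \<le> E u x" "\<And>u x. 0 \<le> F u x"
    and EF: "\<And>u z. u \<in> U \<Longrightarrow> z \<in> carrier K \<Longrightarrow> conv E F u z = (if z = \<one> then 1 else 0)"
    and FE: "\<And>u z. u \<in> U \<Longrightarrow> z \<in> carrier K \<Longrightarrow> conv F E u z = (if z = \<one> then 1 else 0)"
    and u: "u \<in> U"
  shows "\<exists>a\<in>carrier K. \<forall>x\<in>carrier K. E u x \<noteq> 0 \<longleftrightarrow> x = a"
proof -
  have "conv E F u \<one> \<noteq> 0"
    using EF[OF u] by simp
  then obtain a where a: "a \<in> carrier K" "E u a \<noteq> 0" "F (act u a) (inv a) \<noteq> 0"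
    unfolding conv_def by (auto elim!: sum.not_neutral_contains_not_neutral)
  have "x = a" if x: "x \<in> carrier K" "E u x \<noteq> 0" for x
  proof -
    \<comment> \<open>The summands of \<open>conv F E\<close> at \<open>act u a\<close> with label
      \<open>inv a \<otimes> x\<close>. The arrow labelled \<open>inv a\<close> leads back to
      \<open>u\<close>, where \<open>E u x\<close> is nonzero, so this one term keeps the
      non-negative sum from vanishing.\<close>
    let ?t = "\<lambda>y. F (act u a) y * E (act (act u a) y) (inv y \<otimes> (inv a \<otimes> x))"
    have "act (act u a) (inv a) = u"
      using u a by (simp add: act_mult[symmetric] act_one)
    then have "?t (inv a) \<noteq> 0"
      using a x by (simp add: inv_cancel_left)
    moreover have "0 \<le> ?t y" for y
      using nonneg by simp
    ultimately have "conv F E (act u a) (inv a \<otimes> x) \<noteq> 0"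
      unfolding conv_def using a(1) finite_K by (subst sum_nonneg_eq_0_iff) auto
    then have "inv a \<otimes> x = \<one>"
      using FE[OF act_closed[OF u a(1)], of "inv a \<otimes> x"] a x by (auto split: if_splits)
    then show ?thesis
      using a x by (simp add: inv_mult_eq_one_iff)
  qed
  then show ?thesis
    using a by blast
qed

end

section \<open>Matched pairs\<close>

locale factored_group = group G for G :: "'g monoid" (structure) +
  fixes Gp Gm :: "'g set"
  assumes finite_G: "finite (carrier G)" and ufact_G: "ufact G Gp Gm"
begin

abbreviation lm where "lm \<equiv> lact_m G Gp Gm"
abbreviation rp where "rp \<equiv> ract_p G Gp Gm"
abbreviation lp where "lp \<equiv> lact_p G Gp Gm"
abbreviation rm where "rm \<equiv> ract_m G Gp Gm"

lemma subgroup_Gp: "subgroup Gp G" and subgroup_Gm: "subgroup Gm G"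
  using ufact_G by (auto simp: ufact_def)

lemma Gp_closed [simp]:
  "u \<in> Gp \<Longrightarrow> u \<in> carrier G" "\<one> \<in> Gp" "u \<in> Gp \<Longrightarrow> inv u \<in> Gp" "u \<in> Gp \<Longrightarrow> v \<in> Gp \<Longrightarrow> u \<otimes> v \<in> Gp"
  using subgroup_Gp by (auto simp: subgroup.mem_carrier subgroup.one_closed
      subgroup.m_inv_closed subgroup.m_closed)

lemma Gm_closed [simp]:
  "x \<in> Gm \<Longrightarrow> x \<in> carrier G" "\<one> \<in> Gm" "x \<in> Gm \<Longrightarrow> inv x \<in> Gm" "x \<in> Gm \<Longrightarrow> y \<in> Gm \<Longrightarrow> x \<otimes> y \<in> Gm"
  using subgroup_Gm by (auto simp: subgroup.mem_carrier subgroup.one_closed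
      subgroup.m_inv_closed subgroup.m_closed)

lemma finite_Gp [simp]: "finite Gp" and finite_Gm [simp]: "finite Gm"
  using finite_subset[OF subgroup.subset finite_G] subgroup_Gp subgroup_Gm by blast+

lemma factorization_pm:
  assumes "g \<in> carrier G" obtains u x where "u \<in> Gp" "x \<in> Gm" "g = u \<otimes> x"
  using assms ufact_G unfolding ufact_def by (metis mem_Times_iff)

lemma factorization_mp:
  assumes "g \<in> carrier G" obtains x u where "x \<in> Gm" "u \<in> Gp" "g = x \<otimes> u"
proof -
  obtain u x where "u \<in> Gp" "x \<in> Gm" "inv g = u \<otimes> x"
    using assms factorization_pm inv_closed by blast
  moreover from this have "g = inv x \<otimes> inv u"
    using assms by (metis Gm_closed(1) Gp_closed(1) inv_inv inv_mult_group)
  ultimately show ?thesis using that[of "inv x" "inv u"] by simp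
qed

lemma pm_eq_iff [simp]:
  assumes "u \<in> Gp" "v \<in> Gp" "x \<in> Gm" "y \<in> Gm"
  shows "u \<otimes> x = v \<otimes> y \<longleftrightarrow> u = v \<and> x = y"
proof
  assume eq: "u \<otimes> x = v \<otimes> y"
  have "\<exists>!p. p \<in> Gp \<times> Gm \<and> u \<otimes> x = fst p \<otimes> snd p"
    using ufact_G assms unfolding ufact_def by simp
  then have "(u, x) = (v, y)"
    by (rule ex1E) (use eq assms in \<open>metis SigmaI fst_conv snd_conv\<close>)
  then show "u = v \<and> x = y" by simp
qed auto

lemma mp_eq_iff:
  assumes "u \<in> Gp" "v \<in> Gp" "x \<in> Gm" "y \<in> Gm"
  shows "x \<otimes> u = y \<otimes> v \<longleftrightarrow> x = y \<and> u = v"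
proof
  assume "x \<otimes> u = y \<otimes> v"
  then have "inv u \<otimes> inv x = inv v \<otimes> inv y"
    using assms by (metis Gm_closed(1) Gp_closed(1) inv_mult_group)
  then show "x = y \<and> u = v"
    using assms by (metis Gm_closed(1,3) Gp_closed(1,3) inv_inv pm_eq_iff)
qed auto

lemma factor_pm [simp]: "u \<in> Gp \<Longrightarrow> x \<in> Gm \<Longrightarrow> factor G Gp Gm (u \<otimes> x) = (u, x)"
  unfolding factor_def by (rule the_equality) auto

lemma factor_mp [simp]: "u \<in> Gp \<Longrightarrow> x \<in> Gm \<Longrightarrow> factor G Gm Gp (x \<otimes> u) = (x, u)"
  unfolding factor_def by (rule the_equality) (auto simp: mp_eq_iff)

lemma ufp_ufm [simp]:
  "u \<in> Gp \<Longrightarrow> x \<in> Gm \<Longrightarrow> ufp G Gp Gm (u \<otimes> x) = u"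
  "u \<in> Gp \<Longrightarrow> x \<in> Gm \<Longrightarrow> ufm G Gp Gm (u \<otimes> x) = x"
  by (simp_all add: ufp_def ufm_def)

section \<open>The four actions and the matched pair identities\<close>

lemma lm_rp_unique:
  assumes "u \<otimes> x = y \<otimes> v" "v \<in> Gp" "y \<in> Gm"
  shows "lm u x = y" "rp u x = v"
  using assms by (simp_all add: lact_m_def ract_p_def)

lemma lp_rm_unique:
  assumes "x \<otimes> u = v \<otimes> y" "v \<in> Gp" "y \<in> Gm"
  shows "lp x u = v" "rm x u = y"
  using assms by (simp_all add: lact_p_def ract_m_def)

lemma lm_rp:
  assumes "u \<in> Gp" "x \<in> Gm"
  shows "lm u x \<in> Gm" "rp u x \<in> Gp" "u \<otimes> x = lm u x \<otimes> rp u x"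
proof -
  obtain y v where "y \<in> Gm" "v \<in> Gp" "u \<otimes> x = y \<otimes> v"
    using assms factorization_mp by (metis Gm_closed(1) Gp_closed(1) m_closed)
  then show "lm u x \<in> Gm" "rp u x \<in> Gp" "u \<otimes> x = lm u x \<otimes> rp u x"
    using lm_rp_unique by auto
qed

lemma lp_rm:
  assumes "u \<in> Gp" "x \<in> Gm"
  shows "lp x u \<in> Gp" "rm x u \<in> Gm" "x \<otimes> u = lp x u \<otimes> rm x u"
proof -
  obtain v y where "v \<in> Gp" "y \<in> Gm" "x \<otimes> u = v \<otimes> y"
    using assms factorization_pm by (metis Gm_closed(1) Gp_closed(1) m_closed)
  then show "lp x u \<in> Gp" "rm x u \<in> Gm" "x \<otimes> u = lp x u \<otimes> rm x u"
    using lp_rm_unique by auto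
qed

lemmas act_closed [simp] = lm_rp(1,2) lp_rm(1,2)

lemma lm_rp_one [simp]:
  "x \<in> Gm \<Longrightarrow> lm \<one> x = x" "x \<in> Gm \<Longrightarrow> rp \<one> x = \<one>"
  "u \<in> Gp \<Longrightarrow> lm u \<one> = \<one>" "u \<in> Gp \<Longrightarrow> rp u \<one> = u"
  using lm_rp_unique[of \<one> x x \<one>] lm_rp_unique[of u \<one> \<one> u] by simp_all

lemma lp_rm_one [simp]:
  "u \<in> Gp \<Longrightarrow> lp \<one> u = u" "u \<in> Gp \<Longrightarrow> rm \<one> u = \<one>"
  "x \<in> Gm \<Longrightarrow> lp x \<one> = \<one>" "x \<in> Gm \<Longrightarrow> rm x \<one> = x"
  using lp_rm_unique[of \<one> u u \<one>] lp_rm_unique[of x \<one> \<one> x] by simp_all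

text \<open>Moving \<open>x\<close> to the left past \<open>v\<close> and then past \<open>u\<close>
  factorizes \<open>u \<otimes> v \<otimes> x\<close>, and uniqueness reads off both parts. The next
  three lemmas argue in the same way.\<close>

lemma lm_rp_mult_left:
  assumes "u \<in> Gp" "v \<in> Gp" "x \<in> Gm"
  shows "lm (u \<otimes> v) x = lm u (lm v x)" "rp (u \<otimes> v) x = rp u (lm v x) \<otimes> rp v x"
proof -
  have "u \<otimes> v \<otimes> x = u \<otimes> lm v x \<otimes> rp v x"
    using assms lm_rp(3)[of v x] by (simp add: m_assoc)
  also have "\<dots> = lm u (lm v x) \<otimes> (rp u (lm v x) \<otimes> rp v x)"
    using assms lm_rp(3)[of u "lm v x"] by (simp add: m_assoc)
  finally show "lm (u \<otimes> v) x = lm u (lm v x)" "rp (u \<otimes> v) x = rp u (lm v x) \<otimes> rp v x"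
    using assms by (auto intro: lm_rp_unique)
qed

lemma lm_rp_mult_right:
  assumes "u \<in> Gp" "x \<in> Gm" "y \<in> Gm"
  shows "lm u (x \<otimes> y) = lm u x \<otimes> lm (rp u x) y" "rp u (x \<otimes> y) = rp (rp u x) y"
proof -
  have "u \<otimes> (x \<otimes> y) = lm u x \<otimes> (rp u x \<otimes> y)"
    using assms lm_rp(3)[of u x] by (simp add: m_assoc[symmetric])
  also have "\<dots> = lm u x \<otimes> lm (rp u x) y \<otimes> rp (rp u x) y"
    using assms lm_rp(3)[of "rp u x" y] by (simp add: m_assoc)
  finally show "lm u (x \<otimes> y) = lm u x \<otimes> lm (rp u x) y" "rp u (x \<otimes> y) = rp (rp u x) y"
    using assms by (auto intro: lm_rp_unique)
qed

lemma lp_rm_mult_left: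
  assumes "u \<in> Gp" "x \<in> Gm" "y \<in> Gm"
  shows "lp (x \<otimes> y) u = lp x (lp y u)" "rm (x \<otimes> y) u = rm x (lp y u) \<otimes> rm y u"
proof -
  have "x \<otimes> y \<otimes> u = x \<otimes> lp y u \<otimes> rm y u"
    using assms lp_rm(3)[of u y] by (simp add: m_assoc)
  also have "\<dots> = lp x (lp y u) \<otimes> (rm x (lp y u) \<otimes> rm y u)"
    using assms lp_rm(3)[of "lp y u" x] by (simp add: m_assoc)
  finally show "lp (x \<otimes> y) u = lp x (lp y u)" "rm (x \<otimes> y) u = rm x (lp y u) \<otimes> rm y u"
    using assms by (auto intro: lp_rm_unique)
qed

lemma rm_mult_right:
  assumes "u \<in> Gp" "v \<in> Gp" "x \<in> Gm"
  shows "rm x (u \<otimes> v) = rm (rm x u) v"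
proof -
  have "x \<otimes> (u \<otimes> v) = lp x u \<otimes> (rm x u \<otimes> v)"
    using assms lp_rm(3)[of u x] by (simp add: m_assoc[symmetric])
  also have "\<dots> = lp x u \<otimes> lp (rm x u) v \<otimes> rm (rm x u) v"
    using assms lp_rm(3)[of v "rm x u"] by (simp add: m_assoc)
  finally show ?thesis
    using assms by (auto intro: lp_rm_unique)
qed

text \<open>Rewriting \<open>u \<otimes> x\<close> in the opposite order and back returns
  \<open>u\<close> and \<open>x\<close>. With \<open>lm_lp_rm\<close> this gives inverse bijections,
  which later justify substitutions in identities.\<close>

lemma lp_lm_rp [simp]:
  assumes "u \<in> Gp" "x \<in> Gm"
  shows "lp (lm u x) (rp u x) = u" "rm (lm u x) (rp u x) = x"
  using lm_rp(3)[OF assms] assms by (auto intro!: lp_rm_unique)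

lemma lm_lp_rm [simp]:
  assumes "u \<in> Gp" "x \<in> Gm"
  shows "lm (lp x u) (rm x u) = x" "rp (lp x u) (rm x u) = u"
  using lp_rm(3)[OF assms] assms by (auto intro!: lm_rp_unique)

text \<open>Both formulas rearrange \<open>x \<otimes> u = lp x u \<otimes> rm x u\<close>. With
  \<open>x = \<xi> v\<close>, the second one computes where the first component of the arrow of
  \<open>Rxi\<close> ends.\<close>

lemma inv_rm:
  assumes "u \<in> Gp" "x \<in> Gm"
  shows "lm (inv u) (inv x) = inv (rm x u)" "rp u (inv (rm x u)) = lp x u"
proof -
  have "inv (x \<otimes> u) = inv (lp x u \<otimes> rm x u)"
    using lp_rm(3)[OF assms] by simp
  then have "inv u \<otimes> inv x = inv (rm x u) \<otimes> inv (lp x u)"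
    using assms by (simp add: inv_mult_group)
  then show "lm (inv u) (inv x) = inv (rm x u)"
    using assms by (auto intro: lm_rp_unique)
  have "u = inv x \<otimes> (lp x u \<otimes> rm x u)"
    using assms by (simp add: lp_rm(3)[OF assms, symmetric] inv_cancel_left)
  then have "u \<otimes> inv (rm x u) = inv x \<otimes> (lp x u \<otimes> rm x u) \<otimes> inv (rm x u)"
    by simp
  then have "u \<otimes> inv (rm x u) = inv x \<otimes> lp x u"
    using assms by (simp add: m_assoc)
  then show "rp u (inv (rm x u)) = lp x u"
    using assms by (auto intro: lm_rp_unique)
qed

lemma lm_inv_cancel [simp]:
  assumes "u \<in> Gp" "x \<in> Gm"
  shows "lm u (lm (inv u) x) = x" "lm (inv u) (lm u x) = x"
  using assms by (simp_all add: lm_rp_mult_left(1)[symmetric])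

lemma lp_inv_cancel [simp]:
  assumes "u \<in> Gp" "x \<in> Gm"
  shows "lp x (lp (inv x) u) = u" "lp (inv x) (lp x u) = u"
  using assms by (simp_all add: lp_rm_mult_left(1)[symmetric])

lemma rp_inv_cancel [simp]:
  assumes "u \<in> Gp" "x \<in> Gm"
  shows "rp (rp u x) (inv x) = u" "rp (rp u (inv x)) x = u"
  using assms by (simp_all add: lm_rp_mult_right(2)[symmetric])

end

section \<open>The abelian normal subgroup attached to a homomorphism\<close>

locale factored_hom = factored_group G Gp Gm for G :: "'g monoid" (structure) and Gp Gm +
  fixes \<xi> :: "'g \<Rightarrow> 'g"
  assumes xi_hom: "\<xi> \<in> hom (G\<lparr>carrier := Gp\<rparr>) (G\<lparr>carrier := Gm\<rparr>)"
begin

lemma xi_closed [simp]: "u \<in> Gp \<Longrightarrow> \<xi> u \<in> Gm"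
  and xi_mult [simp]: "u \<in> Gp \<Longrightarrow> v \<in> Gp \<Longrightarrow> \<xi> (u \<otimes> v) = \<xi> u \<otimes> \<xi> v"
  using xi_hom by (auto simp: hom_def)

lemma xi_one [simp]: "\<xi> \<one> = \<one>"
proof -
  have "\<xi> \<one> \<otimes> \<xi> \<one> = \<xi> \<one>"
    by (simp add: xi_mult[symmetric] del: xi_mult)
  then show ?thesis by simp
qed

lemma xi_inv [simp]: "u \<in> Gp \<Longrightarrow> \<xi> (inv u) = inv (\<xi> u)"
  by (rule inv_equality[symmetric]) (simp_all add: xi_mult[symmetric] del: xi_mult)

text \<open>Since \<open>\<xi>\<close> is a homomorphism, this is the generic element of
  \<open>Axi\<close>, written so that its factors along \<open>Gp\<close> and \<open>Gm\<close> are
  visible.\<close>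

definition q where "q u = u \<otimes> inv (\<xi> u)"

lemma Axi_eq: "Axi G Gp \<xi> = q ` Gp"
  by (auto simp: Axi_def q_def)

lemma q_closed [simp]: "u \<in> Gp \<Longrightarrow> q u \<in> carrier G"
  by (simp add: q_def)

lemma q_eq_iff [simp]: "u \<in> Gp \<Longrightarrow> v \<in> Gp \<Longrightarrow> q u = q v \<longleftrightarrow> u = v"
  by (auto simp: q_def)

lemma q_in_Axi [simp]: "u \<in> Gp \<Longrightarrow> q u \<in> Axi G Gp \<xi>"
  by (simp add: Axi_eq)

section \<open>The two compatibility identities, normality and commutativity\<close>

definition equivariant :: bool where
  "equivariant \<longleftrightarrow> (\<forall>u\<in>Gp. \<forall>x\<in>Gm. \<xi> (lp x u) \<otimes> rm x u = x \<otimes> \<xi> u)"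

text \<open>Invariance of the product under the candidate braiding that sends \<open>(u, v)\<close>
  to \<open>(lp (\<xi> u) v, rp u (\<xi> v))\<close>, whence the name.\<close>

definition braided_commutative :: bool where
  "braided_commutative \<longleftrightarrow> (\<forall>u\<in>Gp. \<forall>v\<in>Gp. u \<otimes> v = lp (\<xi> u) v \<otimes> rp u (\<xi> v))"

lemma equivariantD:
  "equivariant \<Longrightarrow> u \<in> Gp \<Longrightarrow> x \<in> Gm \<Longrightarrow> \<xi> (lp x u) \<otimes> rm x u = x \<otimes> \<xi> u"
  by (simp add: equivariant_def)

lemma braided_commutativeD:
  "braided_commutative \<Longrightarrow> u \<in> Gp \<Longrightarrow> v \<in> Gp \<Longrightarrow> lp (\<xi> u) v \<otimes> rp u (\<xi> v) = u \<otimes> v"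
  unfolding braided_commutative_def by (rule sym) blast

lemma equivariant_lm:
  assumes equivariant "u \<in> Gp" "x \<in> Gm"
  shows "\<xi> u \<otimes> x = lm u x \<otimes> \<xi> (rp u x)"
  using equivariantD[OF assms(1), of "rp u x" "lm u x"] assms by simp

text \<open>Equivariance turns \<open>inv (x \<otimes> \<xi> u)\<close> into the inverse of
  \<open>\<xi> (lp x u) \<otimes> rm x u\<close>, so the factor \<open>rm x u\<close> produced by
  moving \<open>x\<close> past \<open>u\<close> cancels.\<close>

lemma equivariant_conj:
  assumes equivariant "u \<in> Gp" "x \<in> Gm"
  shows "x \<otimes> q u \<otimes> inv x = q (lp x u)"
proof -
  have "x \<otimes> q u \<otimes> inv x = x \<otimes> u \<otimes> inv (x \<otimes> \<xi> u)"
    using assms by (simp add: q_def m_assoc inv_mult_group)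
  also have "\<dots> = lp x u \<otimes> rm x u \<otimes> inv (\<xi> (lp x u) \<otimes> rm x u)"
    using assms by (simp add: lp_rm(3)[OF assms(2,3)] equivariantD)
  also have "\<dots> = q (lp x u)"
    using assms by (simp add: q_def m_assoc inv_mult_group inv_cancel_left)
  finally show ?thesis .
qed

text \<open>Split along \<open>Gp\<close> and \<open>Gm\<close>, the conjugate of \<open>q u\<close>
  has \<open>Gp\<close> part \<open>lp x u\<close>. Comparing it with \<open>q w\<close> gives
  \<open>w = lp x u\<close>, and the equality of the \<open>Gm\<close> parts is the equivariance
  identity.\<close>

lemma equivariant_if_normalized:
  assumes "\<And>u x. u \<in> Gp \<Longrightarrow> x \<in> Gm \<Longrightarrow> x \<otimes> q u \<otimes> inv x \<in> q ` Gp"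
  shows equivariant
  unfolding equivariant_def
proof (intro ballI)
  fix u x assume u: "u \<in> Gp" and x: "x \<in> Gm"
  then obtain w where w: "w \<in> Gp" "x \<otimes> q u \<otimes> inv x = q w"
    using assms by blast
  have "x \<otimes> q u \<otimes> inv x = x \<otimes> u \<otimes> (inv (\<xi> u) \<otimes> inv x)"
    using u x by (simp add: q_def m_assoc)
  also have "\<dots> = lp x u \<otimes> (rm x u \<otimes> (inv (\<xi> u) \<otimes> inv x))"
    using u x by (simp add: lp_rm(3)[OF u x] m_assoc)
  finally have "lp x u \<otimes> (rm x u \<otimes> (inv (\<xi> u) \<otimes> inv x)) = w \<otimes> inv (\<xi> w)"
    using w by (simp add: q_def)
  then have "lp x u = w" and eq: "rm x u \<otimes> (inv (\<xi> u) \<otimes> inv x) = inv (\<xi> w)"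
    using u x w by (simp_all del: xi_inv)
  have "\<xi> w \<otimes> rm x u \<otimes> (inv (\<xi> u) \<otimes> inv x) = \<one>"
    using u x w eq by (simp add: m_assoc)
  then have "\<xi> w \<otimes> rm x u = inv (inv (\<xi> u) \<otimes> inv x)"
    using u x w by (simp add: inv_equality)
  then show "\<xi> (lp x u) \<otimes> rm x u = x \<otimes> \<xi> u"
    using u x \<open>lp x u = w\<close> by (simp add: inv_mult_group)
qed

text \<open>Conjugating \<open>q v\<close> by \<open>\<xi> u\<close> supplies the factor that
  cancels the \<open>Gm\<close> part of \<open>q u\<close>. Hence the product of \<open>Gp\<close>
  is that of \<open>Axi\<close> twisted by the left action through \<open>\<xi>\<close>.\<close>

lemma q_mult:
  assumes equivariant "u \<in> Gp" "v \<in> Gp"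
  shows "q u \<otimes> q (lp (\<xi> u) v) = q (u \<otimes> v)"
proof -
  have "q u \<otimes> (\<xi> u \<otimes> q v \<otimes> inv (\<xi> u)) = q (u \<otimes> v)"
    using assms by (simp add: q_def m_assoc inv_mult_group inv_cancel_left)
  then show ?thesis
    using assms by (simp add: equivariant_conj)
qed

lemma q_mult':
  assumes equivariant "u \<in> Gp" "v \<in> Gp"
  shows "q u \<otimes> q v = q (u \<otimes> lp (inv (\<xi> u)) v)"
  using assms q_mult[of u "lp (inv (\<xi> u)) v"] by simp

text \<open>Since \<open>v \<otimes> x = q v \<otimes> (\<xi> v \<otimes> x)\<close>, conjugation by
  it is conjugation by an element of \<open>Gm\<close>, which permutes the elements
  \<open>q u\<close>, followed by conjugation by an element of \<open>Axi\<close>.\<close>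

lemma normal_Axi:
  assumes equivariant
  shows "Axi G Gp \<xi> \<lhd> G"
proof -
  have A: "subgroup (q ` Gp) G"
  proof (rule subgroupI)
    show "q ` Gp \<subseteq> carrier G" by (rule image_subsetI) simp
    show "q ` Gp \<noteq> {}" using Gp_closed(2) by (metis empty_iff image_is_empty)
  next
    fix a assume "a \<in> q ` Gp"
    then obtain u where u: "u \<in> Gp" "a = q u" by blast
    have "inv (q u) = \<xi> u \<otimes> q (inv u) \<otimes> inv (\<xi> u)"
      using u by (simp add: q_def inv_mult_group m_assoc)
    also have "\<dots> = q (lp (\<xi> u) (inv u))"
      using u by (intro equivariant_conj[OF assms]) simp_all
    finally show "inv a \<in> q ` Gp"
      using u by simp
  next
    fix a b assume "a \<in> q ` Gp" "b \<in> q ` Gp"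
    then obtain u v where "u \<in> Gp" "v \<in> Gp" "a = q u" "b = q v" by blast
    then show "a \<otimes> b \<in> q ` Gp"
      by (simp add: q_mult'[OF assms])
  qed
  have "g \<otimes> q u \<otimes> inv g \<in> q ` Gp" if g: "g \<in> carrier G" and u: "u \<in> Gp" for g u
  proof -
    obtain v x where vx: "v \<in> Gp" "x \<in> Gm" "g = v \<otimes> x"
      using g by (rule factorization_pm)
    let ?w = "lp (\<xi> v \<otimes> x) u"
    have "g \<otimes> q u \<otimes> inv g = q v \<otimes> ((\<xi> v \<otimes> x) \<otimes> q u \<otimes> inv (\<xi> v \<otimes> x)) \<otimes> inv (q v)"
      using vx u by (simp add: q_def m_assoc inv_mult_group inv_cancel_left)
    also have "\<dots> = q v \<otimes> q ?w \<otimes> inv (q v)"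
      using vx u by (subst equivariant_conj[OF assms]) simp_all
    also have "\<dots> \<in> q ` Gp"
      using vx u by (intro subgroup.m_closed[OF A] subgroup.m_inv_closed[OF A]) auto
    finally show ?thesis .
  qed
  with A show ?thesis
    unfolding Axi_eq normal_inv_iff by blast
qed

text \<open>Applying \<open>\<xi>\<close> to braided commutativity and expanding
  \<open>\<xi> v \<otimes> \<xi> u\<close> by equivariance gives products with a common factor,
  which is cancelled.\<close>

lemma lm_xi:
  assumes equivariant braided_commutative "u \<in> Gp" "v \<in> Gp"
  shows "rm (\<xi> v) u = \<xi> (rp v (\<xi> u))" "lm v (\<xi> u) = \<xi> (lp (\<xi> v) u)"
proof -
  have vu: "\<xi> v \<otimes> \<xi> u = \<xi> (lp (\<xi> v) u) \<otimes> \<xi> (rp v (\<xi> u))"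
    using assms(2-4) by (simp add: xi_mult[symmetric] braided_commutativeD del: xi_mult)
  then have "\<xi> (lp (\<xi> v) u) \<otimes> rm (\<xi> v) u = \<xi> (lp (\<xi> v) u) \<otimes> \<xi> (rp v (\<xi> u))"
    using equivariantD[OF assms(1), of u "\<xi> v"] assms(3,4) by simp
  then show "rm (\<xi> v) u = \<xi> (rp v (\<xi> u))"
    using assms(3,4) by simp
  have "lm v (\<xi> u) \<otimes> \<xi> (rp v (\<xi> u)) = \<xi> (lp (\<xi> v) u) \<otimes> \<xi> (rp v (\<xi> u))"
    using equivariant_lm[OF assms(1), of v "\<xi> u"] assms(3,4) vu by simp
  then show "lm v (\<xi> u) = \<xi> (lp (\<xi> v) u)"
    using assms(3,4) by simp
qed

text \<open>The second factor has the form \<open>w = lp (\<xi> u) v\<close> because then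
  \<open>q_mult\<close> and \<open>q_mult'\<close> write both products as values of the injective
  map \<open>q\<close>. Every element of \<open>Gp\<close> has this form.\<close>

lemma q_commute_iff:
  assumes eqv: equivariant and u: "u \<in> Gp" and v: "v \<in> Gp"
  defines "w \<equiv> lp (\<xi> u) v"
  shows "q u \<otimes> q w = q w \<otimes> q u \<longleftrightarrow> u \<otimes> v = w \<otimes> lp (inv (\<xi> w)) u"
  using assms by (simp add: q_mult q_mult')

lemma q_commute:
  assumes eqv: equivariant and br: braided_commutative and u: "u \<in> Gp" and v: "v \<in> Gp"
  shows "q u \<otimes> q v = q v \<otimes> q u"
proof -
  define v' where "v' = lp (inv (\<xi> u)) v"
  have v': "v' \<in> Gp" "v = lp (\<xi> u) v'"
    using u v by (simp_all add: v'_def)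
  have "lp (lm u (\<xi> v')) (rp u (\<xi> v')) = u"
    using u v' by simp
  \<comment> \<open>\<open>lm_xi\<close> replaces \<open>lm u (\<xi> v')\<close> by
    \<open>\<xi> v\<close>; inverting its action then identifies the factor
    \<open>lp (inv (\<xi> v)) u\<close> required by \<open>q_commute_iff\<close>.\<close>
  then have "lp (\<xi> v) (rp u (\<xi> v')) = u"
    using lm_xi(2)[OF eqv br v'(1) u] v' by simp
  then have "lp (inv (\<xi> v)) u = rp u (\<xi> v')"
    using u v v' by (metis lp_inv_cancel(2) act_closed(2) xi_closed)
  then have "u \<otimes> v' = lp (\<xi> u) v' \<otimes> lp (inv (\<xi> (lp (\<xi> u) v'))) u"
    using braided_commutativeD[OF br u v'(1)] v'(2) by simp
  then show ?thesis
    using q_commute_iff[OF eqv u v'(1)] v' by simp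
qed

text \<open>Commutation alone gives \<open>u \<otimes> v = w \<otimes> t\<close>. Applying
  \<open>\<xi>\<close> and equivariance yields \<open>rm (\<xi> w) t = \<xi> v\<close>, so
  \<open>\<xi> w \<otimes> t\<close> is the factorization of \<open>u \<otimes> \<xi> v\<close> and
  \<open>t\<close> is the desired factor.\<close>

lemma braided_commutative_if_commute:
  assumes eqv: equivariant
    and comm: "\<And>u v. u \<in> Gp \<Longrightarrow> v \<in> Gp \<Longrightarrow> q u \<otimes> q v = q v \<otimes> q u"
  shows braided_commutative
  unfolding braided_commutative_def
proof (intro ballI)
  fix u v assume u: "u \<in> Gp" and v: "v \<in> Gp"
  define w where "w = lp (\<xi> u) v"
  define t where "t = lp (inv (\<xi> w)) u"
  have w: "w \<in> Gp" and t: "t \<in> Gp" and tu: "lp (\<xi> w) t = u"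
    using u v by (simp_all add: w_def t_def)
  have uv: "u \<otimes> v = w \<otimes> t"
    using q_commute_iff[OF eqv u v] comm[OF u w] by (simp add: w_def t_def)
  have "\<xi> u \<otimes> \<xi> v = \<xi> w \<otimes> \<xi> t"
    using uv u v w t by (metis xi_mult)
  also have "\<dots> = \<xi> u \<otimes> rm (\<xi> w) t"
    using equivariantD[OF eqv t, of "\<xi> w"] w tu by simp
  finally have "rm (\<xi> w) t = \<xi> v"
    using u v w t by simp
  then have "u \<otimes> \<xi> v = \<xi> w \<otimes> t"
    using lp_rm(3)[OF t, of "\<xi> w"] w tu by simp
  then have "rp u (\<xi> v) = t"
    using w t by (auto intro: lm_rp_unique)
  then show "u \<otimes> v = lp (\<xi> u) v \<otimes> rp u (\<xi> v)"
    using uv by (simp add: w_def)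
qed

theorem abelian_normal_iff:
  "Axi G Gp \<xi> \<lhd> G \<and> comm_group (G\<lparr>carrier := Axi G Gp \<xi>\<rparr>) \<longleftrightarrow>
    braided_commutative \<and> equivariant"
proof
  assume *: "Axi G Gp \<xi> \<lhd> G \<and> comm_group (G\<lparr>carrier := Axi G Gp \<xi>\<rparr>)"
  then have eqv: equivariant
    by (intro equivariant_if_normalized) (auto simp: Axi_eq normal_inv_iff)
  moreover have "q u \<otimes> q v = q v \<otimes> q u" if "u \<in> Gp" "v \<in> Gp" for u v
    using comm_groupE(4)[OF conjunct2[OF *], of "q u" "q v"] that by simp
  ultimately show "braided_commutative \<and> equivariant"
    using braided_commutative_if_commute by blast
next
  assume *: "braided_commutative \<and> equivariant"
  then have N: "Axi G Gp \<xi> \<lhd> G"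
    by (simp add: normal_Axi)
  then have "group (G\<lparr>carrier := Axi G Gp \<xi>\<rparr>)"
    by (simp add: normal_imp_subgroup subgroup.subgroup_is_group)
  then have "comm_group (G\<lparr>carrier := Axi G Gp \<xi>\<rparr>)"
    by (rule group.group_comm_groupI) (use * q_commute in \<open>auto simp: Axi_eq\<close>)
  with N show "Axi G Gp \<xi> \<lhd> G \<and> comm_group (G\<lparr>carrier := Axi G Gp \<xi>\<rparr>)"
    by simp
qed

end

section \<open>The Hopf algebra in the coordinates \<open>u x\<close>\<close>

context factored_group
begin

text \<open>With \<open>u \<otimes> x\<close> read as an arrow from \<open>u\<close> to
  \<open>rp u x\<close>, basis elements multiply as arrows of the action groupoid of
  \<open>Gm\<close> on \<open>Gp\<close>.\<close>

lemma bprod_pm: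
  assumes "u \<in> Gp" "x \<in> Gm" "v \<in> Gp" "y \<in> Gm"
  shows "bprod G Gp Gm (u \<otimes> x) (v \<otimes> y) = (if rp u x = v then Some (u \<otimes> (x \<otimes> y)) else None)"
  using assms by (simp add: bprod_def m_assoc)

lemma bprod_closed:
  assumes "g \<in> carrier G" "h \<in> carrier G" "k \<notin> carrier G"
  shows "bprod G Gp Gm g h \<noteq> Some k"
proof -
  obtain u x v y where "u \<in> Gp" "x \<in> Gm" "g = u \<otimes> x" "v \<in> Gp" "y \<in> Gm" "h = v \<otimes> y"
    using assms(1,2) factorization_pm by metis
  then show ?thesis
    using assms(3) by (auto simp: bprod_pm)
qed

lemma sum_carrier: "(\<Sum>g\<in>carrier G. f g) = (\<Sum>u\<in>Gp. \<Sum>x\<in>Gm. f (u \<otimes> x))"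
proof -
  have "bij_betw (\<lambda>(u, x). u \<otimes> x) (Gp \<times> Gm) (carrier G)"
    unfolding bij_betw_def
  proof
    show "inj_on (\<lambda>(u, x). u \<otimes> x) (Gp \<times> Gm)"
      by (rule inj_onI) auto
    show "(\<lambda>(u, x). u \<otimes> x) ` (Gp \<times> Gm) = carrier G"
    proof
      show "carrier G \<subseteq> (\<lambda>(u, x). u \<otimes> x) ` (Gp \<times> Gm)"
        by (rule subsetI, erule factorization_pm) force
    qed auto
  qed
  from sum.reindex_bij_betw[OF this, of f, symmetric]
  show ?thesis
    by (simp add: sum.cartesian_product case_prod_beta)
qed

text \<open>In a splitting of the arrow \<open>w \<otimes> z\<close> the first arrow starts at
  \<open>w\<close> with a free label \<open>x\<close>, and the second arrow is then
  determined.\<close>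

lemma sum_bprod:
  fixes F :: "'g \<Rightarrow> 'g \<Rightarrow> complex"
  assumes w: "w \<in> Gp" and z: "z \<in> Gm"
  shows "(\<Sum>g\<in>carrier G. \<Sum>h\<in>carrier G. if bprod G Gp Gm g h = Some (w \<otimes> z) then F g h else 0)
    = (\<Sum>x\<in>Gm. F (w \<otimes> x) (rp w x \<otimes> (inv x \<otimes> z)))"
proof -
  have inner: "(\<Sum>v\<in>Gp. \<Sum>y\<in>Gm.
        if bprod G Gp Gm (u \<otimes> x) (v \<otimes> y) = Some (w \<otimes> z) then F (u \<otimes> x) (v \<otimes> y) else 0)
      = (if u = w then F (u \<otimes> x) (rp u x \<otimes> (inv x \<otimes> z)) else 0)"
    if u: "u \<in> Gp" and x: "x \<in> Gm" for u x
  proof -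
    have "(\<Sum>v\<in>Gp. \<Sum>y\<in>Gm.
        if bprod G Gp Gm (u \<otimes> x) (v \<otimes> y) = Some (w \<otimes> z) then F (u \<otimes> x) (v \<otimes> y) else 0)
      = (\<Sum>v\<in>Gp. \<Sum>y\<in>Gm. if y = inv x \<otimes> z then
          (if v = rp u x then (if u = w then F (u \<otimes> x) (v \<otimes> y) else 0) else 0) else 0)"
    proof (intro sum.cong refl)
      fix v y assume "v \<in> Gp" "y \<in> Gm"
      moreover have "x \<otimes> y = z \<longleftrightarrow> y = inv x \<otimes> z"
        using x z \<open>y \<in> Gm\<close> by (auto simp: inv_cancel_left)
      ultimately show "(if bprod G Gp Gm (u \<otimes> x) (v \<otimes> y) = Some (w \<otimes> z) then F (u \<otimes> x) (v \<otimes> y) else 0)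
          = (if y = inv x \<otimes> z then
          (if v = rp u x then (if u = w then F (u \<otimes> x) (v \<otimes> y) else 0) else 0) else 0)"
        using u x w z by (auto simp: bprod_pm)
    qed
    also have "\<dots> = (if u = w then F (u \<otimes> x) (rp u x \<otimes> (inv x \<otimes> z)) else 0)"
      using u x z by simp
    finally show ?thesis .
  qed
  have "(\<Sum>g\<in>carrier G. \<Sum>h\<in>carrier G. if bprod G Gp Gm g h = Some (w \<otimes> z) then F g h else 0)
    = (\<Sum>u\<in>Gp. \<Sum>x\<in>Gm. if u = w then F (u \<otimes> x) (rp u x \<otimes> (inv x \<otimes> z)) else 0)"
    unfolding sum_carrier by (intro sum.cong refl inner)
  also have "\<dots> = (\<Sum>x\<in>Gm. \<Sum>u\<in>Gp. if u = w then F (u \<otimes> x) (rp u x \<otimes> (inv x \<otimes> z)) else 0)"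
    by (rule sum.swap)
  also have "\<dots> = (\<Sum>x\<in>Gm. F (w \<otimes> x) (rp w x \<otimes> (inv x \<otimes> z)))"
    using w by simp
  finally show ?thesis .
qed

lemma hmul2_pm:
  assumes "u \<in> Gp" "x \<in> Gm" "v \<in> Gp" "y \<in> Gm"
  shows "hmul2 G Gp Gm A B (u \<otimes> x, v \<otimes> y) = (\<Sum>p\<in>Gm. \<Sum>q\<in>Gm.
    A (u \<otimes> p, v \<otimes> q) * B (rp u p \<otimes> (inv p \<otimes> x), rp v q \<otimes> (inv q \<otimes> y)))"
proof -
  let ?C = "carrier G" and ?b = "bprod G Gp Gm"
  have "hmul2 G Gp Gm A B (u \<otimes> x, v \<otimes> y) =
      (\<Sum>g1\<in>?C. \<Sum>g2\<in>?C. \<Sum>h1\<in>?C. \<Sum>h2\<in>?C.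
        if ?b g1 h1 = Some (u \<otimes> x) then if ?b g2 h2 = Some (v \<otimes> y)
        then A (g1, g2) * B (h1, h2) else 0 else 0)"
    unfolding hmul2_def
    by (simp add: sum.cartesian_product' if_if_eq_conj cong: if_cong)
  \<comment> \<open>The interchange groups the variables of each tensor factor, so that
    \<open>sum_bprod\<close> applies to one factor at a time.\<close>
  also have "\<dots> = (\<Sum>g1\<in>?C. \<Sum>h1\<in>?C. \<Sum>g2\<in>?C. \<Sum>h2\<in>?C.
        if ?b g1 h1 = Some (u \<otimes> x) then if ?b g2 h2 = Some (v \<otimes> y)
        then A (g1, g2) * B (h1, h2) else 0 else 0)"
    by (rule sum.cong[OF refl], rule sum.swap)
  also have "\<dots> = (\<Sum>g1\<in>?C. \<Sum>h1\<in>?C. if ?b g1 h1 = Some (u \<otimes> x) then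
       (\<Sum>g2\<in>?C. \<Sum>h2\<in>?C. if ?b g2 h2 = Some (v \<otimes> y) then A (g1, g2) * B (h1, h2) else 0) else 0)"
    by (intro sum.cong refl) simp
  finally show ?thesis
    using assms by (simp add: sum_bprod)
qed

lemma hmul3_pm:
  assumes "u \<in> Gp" "x \<in> Gm" "v \<in> Gp" "y \<in> Gm" "w \<in> Gp" "z \<in> Gm"
  shows "hmul3 G Gp Gm A B (u \<otimes> x, v \<otimes> y, w \<otimes> z) = (\<Sum>p\<in>Gm. \<Sum>q\<in>Gm. \<Sum>r\<in>Gm.
    A (u \<otimes> p, v \<otimes> q, w \<otimes> r) *
    B (rp u p \<otimes> (inv p \<otimes> x), rp v q \<otimes> (inv q \<otimes> y), rp w r \<otimes> (inv r \<otimes> z)))"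
proof -
  let ?C = "carrier G" and ?b = "bprod G Gp Gm"
  let ?t = "\<lambda>g1 g2 g3 h1 h2 h3. if ?b g1 h1 = Some (u \<otimes> x) then
      if ?b g2 h2 = Some (v \<otimes> y) then
      if ?b g3 h3 = Some (w \<otimes> z) then A (g1, g2, g3) * B (h1, h2, h3) else 0 else 0 else 0"
  have if_sum: "(if c then sum f S else 0) = (\<Sum>g\<in>S. if c then f g else 0)"
    for c S and f :: "'g \<Rightarrow> complex"
    by simp
  have "hmul3 G Gp Gm A B (u \<otimes> x, v \<otimes> y, w \<otimes> z) =
      (\<Sum>g1\<in>?C. \<Sum>g2\<in>?C. \<Sum>g3\<in>?C. \<Sum>h1\<in>?C. \<Sum>h2\<in>?C. \<Sum>h3\<in>?C. ?t g1 g2 g3 h1 h2 h3)"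
    unfolding hmul3_def
    by (simp add: sum.cartesian_product' if_if_eq_conj cong: if_cong)
  also have "\<dots> = (\<Sum>g1\<in>?C. \<Sum>g2\<in>?C. \<Sum>h1\<in>?C. \<Sum>g3\<in>?C. \<Sum>h2\<in>?C. \<Sum>h3\<in>?C. ?t g1 g2 g3 h1 h2 h3)"
    by (rule sum.cong[OF refl], rule sum.cong[OF refl], rule sum.swap)
  also have "\<dots> = (\<Sum>g1\<in>?C. \<Sum>h1\<in>?C. \<Sum>g2\<in>?C. \<Sum>g3\<in>?C. \<Sum>h2\<in>?C. \<Sum>h3\<in>?C. ?t g1 g2 g3 h1 h2 h3)"
    by (rule sum.cong[OF refl], rule sum.swap)
  also have "\<dots> = (\<Sum>g1\<in>?C. \<Sum>h1\<in>?C. \<Sum>g2\<in>?C. \<Sum>h2\<in>?C. \<Sum>g3\<in>?C. \<Sum>h3\<in>?C. ?t g1 g2 g3 h1 h2 h3)"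
    by (rule sum.cong[OF refl], rule sum.cong[OF refl], rule sum.cong[OF refl], rule sum.swap)
  also have "\<dots> = (\<Sum>g1\<in>?C. \<Sum>h1\<in>?C. if ?b g1 h1 = Some (u \<otimes> x) then
       (\<Sum>g2\<in>?C. \<Sum>h2\<in>?C. if ?b g2 h2 = Some (v \<otimes> y) then
       (\<Sum>g3\<in>?C. \<Sum>h3\<in>?C. if ?b g3 h3 = Some (w \<otimes> z) then
          A (g1, g2, g3) * B (h1, h2, h3) else 0) else 0) else 0)"
    by (simp only: if_sum)
  finally show ?thesis
    using assms by (simp add: sum_bprod)
qed

lemma hmul2_outside:
  "k1 \<notin> carrier G \<or> k2 \<notin> carrier G \<Longrightarrow> hmul2 G Gp Gm A B (k1, k2) = 0"
  by (auto simp: hmul2_def sum.cartesian_product' bprod_closed cong: sum.cong)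

lemma hmul3_outside:
  "k1 \<notin> carrier G \<or> k2 \<notin> carrier G \<or> k3 \<notin> carrier G \<Longrightarrow> hmul3 G Gp Gm A B (k1, k2, k3) = 0"
  by (auto simp: hmul3_def sum.cartesian_product' bprod_closed cong: sum.cong)

text \<open>Matching the legs of a summand with \<open>u \<otimes> x\<close> and
  \<open>v \<otimes> y\<close> forces \<open>h = v\<close> and
  \<open>g = u \<otimes> v \<otimes> y\<close>; only the condition on \<open>x\<close> is
  left.\<close>

lemma hcomul_pm:
  assumes u: "u \<in> Gp" and x: "x \<in> Gm" and v: "v \<in> Gp" and y: "y \<in> Gm"
  shows "hcomul G Gp Gm f (u \<otimes> x, v \<otimes> y) = (if x = lm v y then f (u \<otimes> v \<otimes> y) else 0)"
proof -
  have "hcomul G Gp Gm f (u \<otimes> x, v \<otimes> y) = (\<Sum>w\<in>Gp. \<Sum>z\<in>Gm. \<Sum>h\<in>Gp.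
      if h = v then (if z = y then (if w = u \<otimes> v then (if x = lm v y then f (w \<otimes> y) else 0) else 0) else 0) else 0)"
    unfolding hcomul_def sum_carrier prod.case
  proof (intro sum.cong refl)
    fix w z h assume wzh: "w \<in> Gp" "z \<in> Gm" "h \<in> Gp"
    have "u = w \<otimes> inv v \<longleftrightarrow> w = u \<otimes> v"
      using wzh u v by (auto simp: m_assoc)
    then show "(if u \<otimes> x = ufp G Gp Gm (w \<otimes> z) \<otimes> inv h \<otimes> lm h (ufm G Gp Gm (w \<otimes> z)) \<and>
             v \<otimes> y = h \<otimes> ufm G Gp Gm (w \<otimes> z) then f (w \<otimes> z) else 0)
        = (if h = v then (if z = y then (if w = u \<otimes> v then (if x = lm v y then f (w \<otimes> y) else 0) else 0) else 0) else 0)"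
      using wzh assms by auto
  qed
  also have "\<dots> = (if x = lm v y then f (u \<otimes> v \<otimes> y) else 0)"
    using assms by simp
  finally show ?thesis .
qed

lemma hcomul_outside:
  assumes "k1 \<notin> carrier G \<or> k2 \<notin> carrier G"
  shows "hcomul G Gp Gm f (k1, k2) = 0"
  unfolding hcomul_def sum_carrier prod.case
  by (intro sum.neutral ballI) (use assms in auto)

lemma hcomul_zero: "hcomul G Gp Gm (\<lambda>_. 0) k = 0"
  by (cases k) (simp add: hcomul_def)

lemma hunit_pm:
  assumes "u \<in> Gp" "x \<in> Gm"
  shows "hunit Gp (u \<otimes> x) = (if x = \<one> then 1 else 0)"
proof -
  have "u \<otimes> x \<in> Gp \<longleftrightarrow> x = \<one>"
    using assms pm_eq_iff[of u "u \<otimes> x" x \<one>] by auto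
  then show ?thesis
    by (simp add: hunit_def)
qed

lemma hunit_outside: "k \<notin> carrier G \<Longrightarrow> hunit Gp k = 0"
  by (auto simp: hunit_def)

lemma sum_hcounit: "(\<Sum>g\<in>carrier G. hcounit G Gp Gm g * f g) = (\<Sum>x\<in>Gm. f x)"
proof -
  have "(\<Sum>g\<in>carrier G. hcounit G Gp Gm g * f g) = (\<Sum>u\<in>Gp. \<Sum>x\<in>Gm. if u = \<one> then f x else 0)"
    unfolding sum_carrier by (intro sum.cong refl) (simp add: hcounit_def)
  also have "\<dots> = (\<Sum>x\<in>Gm. \<Sum>u\<in>Gp. if u = \<one> then f x else 0)"
    by (rule sum.swap)
  finally show ?thesis by simp
qed

lemma ext_pm2:
  assumes "\<And>k1 k2. k1 \<notin> carrier G \<or> k2 \<notin> carrier G \<Longrightarrow> A (k1, k2) = B (k1, k2)"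
    and "\<And>u x v y. u \<in> Gp \<Longrightarrow> x \<in> Gm \<Longrightarrow> v \<in> Gp \<Longrightarrow> y \<in> Gm \<Longrightarrow>
      A (u \<otimes> x, v \<otimes> y) = B (u \<otimes> x, v \<otimes> y)"
  shows "A = B"
proof (rule ext, clarify)
  fix k1 k2
  show "A (k1, k2) = B (k1, k2)"
  proof (cases "k1 \<in> carrier G \<and> k2 \<in> carrier G")
    case True
    then show ?thesis
      using assms(2) by (metis factorization_pm)
  next
    case False
    then show ?thesis
      using assms(1) by blast
  qed
qed

lemma ext_pm3:
  assumes "\<And>k1 k2 k3. k1 \<notin> carrier G \<or> k2 \<notin> carrier G \<or> k3 \<notin> carrier G \<Longrightarrow>
      A (k1, k2, k3) = B (k1, k2, k3)"
    and "\<And>u x v y w z. u \<in> Gp \<Longrightarrow> x \<in> Gm \<Longrightarrow> v \<in> Gp \<Longrightarrow> y \<in> Gm \<Longrightarrow> w \<in> Gp \<Longrightarrow> z \<in> Gm \<Longrightarrow>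
      A (u \<otimes> x, v \<otimes> y, w \<otimes> z) = B (u \<otimes> x, v \<otimes> y, w \<otimes> z)"
  shows "A = B"
proof (rule ext, clarify)
  fix k1 k2 k3
  show "A (k1, k2, k3) = B (k1, k2, k3)"
  proof (cases "k1 \<in> carrier G \<and> k2 \<in> carrier G \<and> k3 \<in> carrier G")
    case True
    then obtain u x v y w z where "u \<in> Gp" "x \<in> Gm" "k1 = u \<otimes> x" "v \<in> Gp" "y \<in> Gm" "k2 = v \<otimes> y"
        "w \<in> Gp" "z \<in> Gm" "k3 = w \<otimes> z"
      by (metis factorization_pm)
    then show ?thesis
      using assms(2) by blast
  next
    case False
    then show ?thesis
      using assms(1) by blast
  qed
qed

section \<open>The tensor square as a groupoid convolution algebra\<close>

abbreviation K where "K \<equiv> (G\<lparr>carrier := Gm\<rparr>) \<times>\<times> (G\<lparr>carrier := Gm\<rparr>)"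
abbreviation act2 where "act2 \<equiv> \<lambda>(u, v) (x, y). (rp u x, rp v y)"

lemma group_Gm: "group (G\<lparr>carrier := Gm\<rparr>)"
  using subgroup_Gm by (rule subgroup.subgroup_is_group) (rule is_group)

sublocale conv2: finite_right_action K "Gp \<times> Gp" act2
proof (rule finite_right_action.intro)
  show "group K"
    using DirProd_group[OF group_Gm group_Gm] .
qed (unfold_locales, auto simp: lm_rp_mult_right)

definition coords :: "('g \<times> 'g \<Rightarrow> complex) \<Rightarrow> 'g \<times> 'g \<Rightarrow> 'g \<times> 'g \<Rightarrow> complex" where
  "coords A p r = A (fst p \<otimes> fst r, snd p \<otimes> snd r)"

lemma inv_K: "x \<in> Gm \<Longrightarrow> y \<in> Gm \<Longrightarrow> inv\<^bsub>K\<^esub> (x, y) = (inv x, inv y)"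
  by (simp add: inv_DirProd[OF group_Gm group_Gm] m_inv_consistent[OF subgroup_Gm])

lemma coords_hmul2:
  assumes "u \<in> Gp" "x \<in> Gm" "v \<in> Gp" "y \<in> Gm"
  shows "hmul2 G Gp Gm A B (u \<otimes> x, v \<otimes> y) = conv2.conv (coords A) (coords B) (u, v) (x, y)"
  using assms
  by (simp add: hmul2_pm conv2.conv_def sum.cartesian_product' coords_def inv_K)

abbreviation flip :: "('g \<times> 'g \<Rightarrow> complex) \<Rightarrow> 'g \<times> 'g \<Rightarrow> complex" where
  "flip A \<equiv> \<lambda>(k1, k2). A (k2, k1)"

lemma hmul2_flip: "hmul2 G Gp Gm (flip A) (flip B) = flip (hmul2 G Gp Gm A B)"
proof (rule ext_pm2)
  fix u x v y assume "u \<in> Gp" "x \<in> Gm" "v \<in> Gp" "y \<in> Gm"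
  then show "hmul2 G Gp Gm (flip A) (flip B) (u \<otimes> x, v \<otimes> y) = flip (hmul2 G Gp Gm A B) (u \<otimes> x, v \<otimes> y)"
    by (simp add: hmul2_pm) (rule sum.swap)
qed (auto simp: hmul2_outside)

lemma hmul2_assoc:
  "hmul2 G Gp Gm (hmul2 G Gp Gm A B) C = hmul2 G Gp Gm A (hmul2 G Gp Gm B C)"
proof (rule ext_pm2)
  fix u x v y assume uv: "u \<in> Gp" "x \<in> Gm" "v \<in> Gp" "y \<in> Gm"
  have *: "coords (hmul2 G Gp Gm A B) p r = conv2.conv (coords A) (coords B) p r"
    if "p \<in> Gp \<times> Gp" "r \<in> Gm \<times> Gm" for p r A B
    using that coords_hmul2[of "fst p" "fst r" "snd p" "snd r" A B] by (auto simp: coords_def)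
  have "conv2.conv (coords (hmul2 G Gp Gm A B)) (coords C) (u, v) (x, y)
      = conv2.conv (conv2.conv (coords A) (coords B)) (coords C) (u, v) (x, y)"
    unfolding conv2.conv_def[of "coords (hmul2 G Gp Gm A B)"] conv2.conv_def[of "conv2.conv _ _"]
    by (rule sum.cong) (use uv in \<open>auto simp: *\<close>)
  also have "\<dots> = conv2.conv (coords A) (conv2.conv (coords B) (coords C)) (u, v) (x, y)"
    by (rule conv2.conv_assoc) (use uv in auto)
  also have "\<dots> = conv2.conv (coords A) (coords (hmul2 G Gp Gm B C)) (u, v) (x, y)"
    unfolding conv2.conv_def[of "coords A"]
    by (rule sum.cong) (use uv in \<open>auto simp: * inv_K\<close>)
  finally show "hmul2 G Gp Gm (hmul2 G Gp Gm A B) C (u \<otimes> x, v \<otimes> y)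
      = hmul2 G Gp Gm A (hmul2 G Gp Gm B C) (u \<otimes> x, v \<otimes> y)"
    using uv by (simp add: coords_hmul2)
qed (auto simp: hmul2_outside)

lemma hunit2_pm:
  "u \<in> Gp \<Longrightarrow> x \<in> Gm \<Longrightarrow> v \<in> Gp \<Longrightarrow> y \<in> Gm \<Longrightarrow>
    hunit2 Gp (u \<otimes> x, v \<otimes> y) = (if x = \<one> \<and> y = \<one> then 1 else 0)"
  by (simp add: hunit2_def hunit_pm)

lemma hunit2_one: "u \<in> Gp \<Longrightarrow> v \<in> Gp \<Longrightarrow> hunit2 Gp (u, v) = 1"
  by (simp add: hunit2_def hunit_def)

lemma hunit2_outside: "k1 \<notin> carrier G \<or> k2 \<notin> carrier G \<Longrightarrow> hunit2 Gp (k1, k2) = 0"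
  by (auto simp: hunit2_def hunit_outside)

lemma flip_hunit2: "flip (hunit2 Gp) = hunit2 Gp"
  by (auto simp: hunit2_def)

lemma hmul2_unit_right:
  assumes "A \<in> H2 G"
  shows "hmul2 G Gp Gm A (hunit2 Gp) = A"
proof (rule ext_pm2)
  fix u x v y assume uv: "u \<in> Gp" "x \<in> Gm" "v \<in> Gp" "y \<in> Gm"
  then have "hmul2 G Gp Gm A (hunit2 Gp) (u \<otimes> x, v \<otimes> y) = coords A (u, v) (x, y)"
    unfolding coords_hmul2[OF uv]
    by (intro conv2.conv_unit_right)
      (auto simp: coords_def hunit2_pm hunit2_one split: if_splits)
  then show "hmul2 G Gp Gm A (hunit2 Gp) (u \<otimes> x, v \<otimes> y) = A (u \<otimes> x, v \<otimes> y)"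
    by (simp add: coords_def)
qed (use assms in \<open>auto simp: hmul2_outside H2_def\<close>)

text \<open>When \<open>A\<close> has at most one arrow over \<open>(u, v)\<close>, the convolution
  reduces to following that arrow and evaluating \<open>B\<close> at its end point.\<close>

lemma hmul2_monomial:
  assumes "u \<in> Gp" "x \<in> Gm" "v \<in> Gp" "y \<in> Gm" "a \<in> Gm" "b \<in> Gm"
    and "\<And>p q. p \<in> Gm \<Longrightarrow> q \<in> Gm \<Longrightarrow> A (u \<otimes> p, v \<otimes> q) \<noteq> 0 \<Longrightarrow> p = a \<and> q = b"
  shows "hmul2 G Gp Gm A B (u \<otimes> x, v \<otimes> y) =
    A (u \<otimes> a, v \<otimes> b) * B (rp u a \<otimes> (inv a \<otimes> x), rp v b \<otimes> (inv b \<otimes> y))"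
proof -
  have "coords A (u, v) r = 0" if "r \<in> carrier K" "r \<noteq> (a, b)" for r
    using that assms(7)[of "fst r" "snd r"] by (cases r) (auto simp: coords_def)
  with assms(5,6) show ?thesis
    unfolding coords_hmul2[OF assms(1-4)]
    by (subst conv2.conv_single[of "(a, b)"]) (simp_all add: coords_def inv_K)
qed

text \<open>The unit in the second leg of the left factor forces \<open>q = \<one>\<close>, and the
  unit in the first leg of the right factor forces \<open>p = x1\<close>; only the third leg keeps a
  summation variable.\<close>

lemma hmul3_13_23:
  assumes "u1 \<in> Gp" "x1 \<in> Gm" "u2 \<in> Gp" "x2 \<in> Gm" "v \<in> Gp" "y \<in> Gm"
  shows "hmul3 G Gp Gm (\<lambda>(k1, k2, k3). R (k1, k3) * hunit Gp k2)
      (\<lambda>(k1, k2, k3). hunit Gp k1 * R (k2, k3)) (u1 \<otimes> x1, u2 \<otimes> x2, v \<otimes> y) =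
    (\<Sum>r\<in>Gm. R (u1 \<otimes> x1, v \<otimes> r) * R (u2 \<otimes> x2, rp v r \<otimes> (inv r \<otimes> y)))"
proof -
  have "hmul3 G Gp Gm (\<lambda>(k1, k2, k3). R (k1, k3) * hunit Gp k2)
      (\<lambda>(k1, k2, k3). hunit Gp k1 * R (k2, k3)) (u1 \<otimes> x1, u2 \<otimes> x2, v \<otimes> y) =
    (\<Sum>p\<in>Gm. \<Sum>q\<in>Gm. if q = \<one> then (if p = x1 then (\<Sum>r\<in>Gm.
      R (u1 \<otimes> p, v \<otimes> r) * R (rp u2 q \<otimes> (inv q \<otimes> x2), rp v r \<otimes> (inv r \<otimes> y))) else 0) else 0)"
    unfolding hmul3_pm[OF assms] prod.case
    by (intro sum.cong refl) (use assms in \<open>auto simp: hunit_pm inv_mult_eq_one_iff\<close>)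
  then show ?thesis
    using assms by simp
qed

lemma hmul3_13_12:
  assumes "u \<in> Gp" "x \<in> Gm" "v1 \<in> Gp" "y1 \<in> Gm" "v2 \<in> Gp" "y2 \<in> Gm"
  shows "hmul3 G Gp Gm (\<lambda>(k1, k2, k3). R (k1, k3) * hunit Gp k2)
      (\<lambda>(k1, k2, k3). R (k1, k2) * hunit Gp k3) (u \<otimes> x, v1 \<otimes> y1, v2 \<otimes> y2) =
    (\<Sum>p\<in>Gm. R (u \<otimes> p, v2 \<otimes> y2) * R (rp u p \<otimes> (inv p \<otimes> x), v1 \<otimes> y1))"
proof -
  have "hmul3 G Gp Gm (\<lambda>(k1, k2, k3). R (k1, k3) * hunit Gp k2)
      (\<lambda>(k1, k2, k3). R (k1, k2) * hunit Gp k3) (u \<otimes> x, v1 \<otimes> y1, v2 \<otimes> y2) =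
    (\<Sum>p\<in>Gm. \<Sum>q\<in>Gm. if q = \<one> then
      R (u \<otimes> p, v2 \<otimes> y2) * R (rp u p \<otimes> (inv p \<otimes> x), v1 \<otimes> y1) else 0)"
    unfolding hmul3_pm[OF assms] prod.case
    by (intro sum.cong refl) (use assms in \<open>auto simp: hunit_pm inv_mult_eq_one_iff if_distrib cong: if_cong\<close>)
  then show ?thesis
    using assms by simp
qed

end

section \<open>The triangular structure defined by a homomorphism\<close>

context factored_hom
begin

lemma Rxi_pm:
  assumes "u \<in> Gp" "x \<in> Gm" "v \<in> Gp" "y \<in> Gm"
  shows "Rxi G Gp Gm \<xi> (u \<otimes> x, v \<otimes> y) = (if x = inv (rm (\<xi> v) u) \<and> y = \<xi> u then 1 else 0)"
proof -
  have "Rxi G Gp Gm \<xi> (u \<otimes> x, v \<otimes> y) = (\<Sum>u'\<in>Gp. \<Sum>v'\<in>Gp. if v' = v then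
      (if u' = u then (if x = inv (rm (\<xi> v) u) \<and> y = \<xi> u then 1 else 0) else 0) else 0)"
    unfolding Rxi_def prod.case by (intro sum.cong refl) (use assms in auto)
  then show ?thesis
    using assms by simp
qed

lemma Rxi_outside:
  assumes "k1 \<notin> carrier G \<or> k2 \<notin> carrier G"
  shows "Rxi G Gp Gm \<xi> (k1, k2) = 0"
  unfolding Rxi_def prod.case by (intro sum.neutral ballI) (use assms in auto)

lemma Rxi_H2: "Rxi G Gp Gm \<xi> \<in> H2 G"
  by (auto simp: H2_def Rxi_outside)

lemma positive_Rxi: "positive (Rxi G Gp Gm \<xi>)"
  unfolding positive_def
proof (clarify)
  fix k1 k2
  have "Rxi G Gp Gm \<xi> (k1, k2) \<in> {0, 1}"
  proof (cases "k1 \<in> carrier G \<and> k2 \<in> carrier G")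
    case True
    then obtain u x v y where "u \<in> Gp" "x \<in> Gm" "k1 = u \<otimes> x" "v \<in> Gp" "y \<in> Gm" "k2 = v \<otimes> y"
      by (metis factorization_pm)
    then show ?thesis
      by (simp add: Rxi_pm)
  qed (auto simp: Rxi_outside)
  then show "Im (Rxi G Gp Gm \<xi> (k1, k2)) = 0 \<and> 0 \<le> Re (Rxi G Gp Gm \<xi> (k1, k2))"
    by auto
qed

text \<open>\<open>Rxi\<close> has a single arrow over \<open>(u, v)\<close>, and
  \<open>inv_rm\<close> computes the first component of its end point. Left multiplication by
  \<open>Rxi\<close> is therefore a substitution of arguments.\<close>

lemma hmul2_Rxi:
  assumes "u \<in> Gp" "x \<in> Gm" "v \<in> Gp" "y \<in> Gm"
  shows "hmul2 G Gp Gm (Rxi G Gp Gm \<xi>) B (u \<otimes> x, v \<otimes> y) =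
    B (lp (\<xi> v) u \<otimes> (rm (\<xi> v) u \<otimes> x), rp v (\<xi> u) \<otimes> (inv (\<xi> u) \<otimes> y))"
proof -
  have "hmul2 G Gp Gm (Rxi G Gp Gm \<xi>) B (u \<otimes> x, v \<otimes> y) =
      Rxi G Gp Gm \<xi> (u \<otimes> inv (rm (\<xi> v) u), v \<otimes> \<xi> u) *
      B (rp u (inv (rm (\<xi> v) u)) \<otimes> (inv (inv (rm (\<xi> v) u)) \<otimes> x), rp v (\<xi> u) \<otimes> (inv (\<xi> u) \<otimes> y))"
    by (rule hmul2_monomial) (use assms in \<open>auto simp: Rxi_pm split: if_splits\<close>)
  then show ?thesis
    using assms by (simp add: Rxi_pm inv_rm)
qed

section \<open>The triangularity axioms for \<open>Rxi\<close>\<close>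

context
  assumes eqv: equivariant and br: braided_commutative
begin

text \<open>By \<open>lm_xi\<close>, the arrow of the flipped element that starts where the arrow of
  \<open>Rxi\<close> ends carries the inverse labels, so the two compose to an identity
  arrow.\<close>

lemma Rxi_inverse:
  "hmul2 G Gp Gm (Rxi G Gp Gm \<xi>) (flip (Rxi G Gp Gm \<xi>)) = hunit2 Gp"
proof (rule ext_pm2)
  fix u x v y assume uv: "u \<in> Gp" "x \<in> Gm" "v \<in> Gp" "y \<in> Gm"
  have 1: "rm (\<xi> (lp (\<xi> v) u)) (rp v (\<xi> u)) = \<xi> u"
    using uv by (simp add: lm_xi(2)[OF eqv br, symmetric])
  have 2: "inv (\<xi> u) \<otimes> y = inv (\<xi> u) \<longleftrightarrow> y = \<one>"
    using uv by (metis Gm_closed(1) inv_closed r_one l_cancel one_closed xi_closed)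
  have 3: "rm (\<xi> v) u \<otimes> x = rm (\<xi> v) u \<longleftrightarrow> x = \<one>"
    using uv by simp
  show "hmul2 G Gp Gm (Rxi G Gp Gm \<xi>) (flip (Rxi G Gp Gm \<xi>)) (u \<otimes> x, v \<otimes> y)
      = hunit2 Gp (u \<otimes> x, v \<otimes> y)"
    using uv by (simp add: hmul2_Rxi Rxi_pm hunit2_pm lm_xi(1)[OF eqv br, symmetric] 1 2 3 conj_commute)
qed (auto simp: hmul2_outside hunit2_outside)

lemma Rxi_inverse': "hmul2 G Gp Gm (flip (Rxi G Gp Gm \<xi>)) (Rxi G Gp Gm \<xi>) = hunit2 Gp"
  using hmul2_flip[of "Rxi G Gp Gm \<xi>" "flip (Rxi G Gp Gm \<xi>)"]
  by (simp add: Rxi_inverse flip_hunit2 case_prod_eta)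

text \<open>At given coordinates each side has at most one term. Equivariance and
  \<open>lm_xi\<close> match the conditions for that term, and braided commutativity matches the
  argument of \<open>f\<close>.\<close>

lemma Rxi_intertwines:
  "hmul2 G Gp Gm (flip (hcomul G Gp Gm f)) (Rxi G Gp Gm \<xi>)
    = hmul2 G Gp Gm (Rxi G Gp Gm \<xi>) (hcomul G Gp Gm f)"
proof (rule ext_pm2)
  fix u x v y assume uv: "u \<in> Gp" "x \<in> Gm" "v \<in> Gp" "y \<in> Gm"
  \<comment> \<open>The arrow of \<open>Rxi\<close> over \<open>(u, v)\<close> ends at
    \<open>v'\<close> in its second component and leaves the label \<open>p0\<close> of
    \<open>y\<close>; \<open>p0\<close> is also the only label \<open>p\<close> that the left side
    allows.\<close>
  define v' where "v' = rp v (\<xi> u)"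
  define p0 where "p0 = inv (\<xi> u) \<otimes> y"
  have v': "v' \<in> Gp" and p0: "p0 \<in> Gm"
    using uv by (simp_all add: v'_def p0_def)
  let ?c = "\<lambda>p. x = p \<otimes> inv (\<xi> (rp v' p))"
  have "hmul2 G Gp Gm (flip (hcomul G Gp Gm f)) (Rxi G Gp Gm \<xi>) (u \<otimes> x, v \<otimes> y) =
    (\<Sum>p\<in>Gm. \<Sum>r\<in>Gm. if r = lm u p then
        (if p = p0 then (if ?c p then f (v \<otimes> u \<otimes> p) else 0) else 0) else 0)"
    unfolding hmul2_pm[OF uv]
  proof (intro sum.cong refl)
    fix p r assume p: "p \<in> Gm" and r: "r \<in> Gm"
    have "(inv p \<otimes> x = inv (rm (\<xi> (rp v r)) (rp u p)) \<and> inv r \<otimes> y = \<xi> (rp u p)) \<longleftrightarrow>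
        p = p0 \<and> ?c p" if r: "r = lm u p"
    proof -
      have eq: "r \<otimes> \<xi> (rp u p) = \<xi> u \<otimes> p"
        using equivariant_lm[OF eqv uv(1) p] r by simp
      have "inv r \<otimes> y = \<xi> (rp u p) \<longleftrightarrow> y = r \<otimes> \<xi> (rp u p)"
        using uv p r by (intro inv_mult_eq_iff) simp_all
      also have "\<dots> \<longleftrightarrow> p = p0"
        unfolding eq p0_def using uv p by (auto simp: inv_cancel_left)
      finally have A: "inv r \<otimes> y = \<xi> (rp u p) \<longleftrightarrow> p = p0" .
      have "rm (\<xi> (rp v r)) (rp u p) = \<xi> (rp (rp v r) (\<xi> (rp u p)))"
        using uv p r by (intro lm_xi(1)[OF eqv br]) simp_all
      also have "rp (rp v r) (\<xi> (rp u p)) = rp v (r \<otimes> \<xi> (rp u p))"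
        using uv p r by (simp add: lm_rp_mult_right)
      also have "\<dots> = rp v' p"
        unfolding eq v'_def using uv p by (simp add: lm_rp_mult_right)
      finally have B: "rm (\<xi> (rp v r)) (rp u p) = \<xi> (rp v' p)" .
      have "inv p \<otimes> x = inv (\<xi> (rp v' p)) \<longleftrightarrow> ?c p"
        using uv p v' by (intro inv_mult_eq_iff) simp_all
      then show ?thesis
        using A B by auto
    qed
    then show "flip (hcomul G Gp Gm f) (u \<otimes> p, v \<otimes> r) *
        Rxi G Gp Gm \<xi> (rp u p \<otimes> (inv p \<otimes> x), rp v r \<otimes> (inv r \<otimes> y)) =
        (if r = lm u p then (if p = p0 then (if ?c p then f (v \<otimes> u \<otimes> p) else 0) else 0) else 0)"
      using uv p r by (simp add: hcomul_pm Rxi_pm)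
  qed
  also have "\<dots> = (if ?c p0 then f (v \<otimes> u \<otimes> p0) else 0)"
    using uv p0 by simp
  \<comment> \<open>Equivariance at \<open>v'\<close> and \<open>p0\<close> converts the condition
    on \<open>x\<close> into the one that the coproduct imposes on the right side.\<close>
  also have "?c p0 \<longleftrightarrow> rm (\<xi> v) u \<otimes> x = lm v' p0"
  proof -
    have "\<xi> v' \<otimes> (p0 \<otimes> inv (\<xi> (rp v' p0))) = lm v' p0"
      using equivariant_lm[OF eqv v' p0] v' p0 by (simp add: m_assoc[symmetric]) (simp add: m_assoc)
    then have "?c p0 \<longleftrightarrow> \<xi> v' \<otimes> x = lm v' p0"
      using v' p0 uv by (metis Gm_closed l_cancel act_closed(2) xi_closed)
    then show ?thesis
      using uv by (simp add: lm_xi(1)[OF eqv br] v'_def)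
  qed
  also have "v \<otimes> u = lp (\<xi> v) u \<otimes> v'"
    using braided_commutativeD[OF br uv(3,1)] by (simp add: v'_def)
  finally show "hmul2 G Gp Gm (flip (hcomul G Gp Gm f)) (Rxi G Gp Gm \<xi>) (u \<otimes> x, v \<otimes> y) =
      hmul2 G Gp Gm (Rxi G Gp Gm \<xi>) (hcomul G Gp Gm f) (u \<otimes> x, v \<otimes> y)"
    using uv by (simp add: hmul2_Rxi hcomul_pm p0_def v'_def)
qed (auto simp: hmul2_outside)

text \<open>Only \<open>r = \<xi> u1\<close> contributes. Then \<open>lm_xi\<close> and
  \<open>rm_mult_right\<close> identify the labels over \<open>u1\<close> and \<open>u2\<close> with
  those of the coproduct, and multiplicativity of \<open>\<xi>\<close> settles the third
  leg.\<close>

lemma Rxi_comul_left: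
  "(\<lambda>(k1, k2, k3). hcomul G Gp Gm (\<lambda>g. Rxi G Gp Gm \<xi> (g, k3)) (k1, k2))
    = hmul3 G Gp Gm (\<lambda>(k1, k2, k3). Rxi G Gp Gm \<xi> (k1, k3) * hunit Gp k2)
        (\<lambda>(k1, k2, k3). hunit Gp k1 * Rxi G Gp Gm \<xi> (k2, k3))" (is "?L = ?R")
proof (rule ext_pm3)
  fix u1 x1 u2 x2 v y
  assume as: "u1 \<in> Gp" "x1 \<in> Gm" "u2 \<in> Gp" "x2 \<in> Gm" "v \<in> Gp" "y \<in> Gm"
  let ?a = "inv (rm (\<xi> v) u1)" and ?b = "inv (rm (\<xi> v) (u1 \<otimes> u2))"
  have 1: "rm (\<xi> (rp v (\<xi> u1))) u2 = rm (\<xi> v) (u1 \<otimes> u2)"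
    using as by (simp add: lm_xi(1)[OF eqv br, symmetric] rm_mult_right)
  have 2: "lm u2 ?b = ?a"
    using as by (simp add: rm_mult_right inv_rm(1)[symmetric])
  have 3: "inv (\<xi> u1) \<otimes> y = \<xi> u2 \<longleftrightarrow> y = \<xi> u1 \<otimes> \<xi> u2"
    using as by (intro inv_mult_eq_iff) simp_all
  have "?R (u1 \<otimes> x1, u2 \<otimes> x2, v \<otimes> y) = (\<Sum>r\<in>Gm. if r = \<xi> u1 then
      (if x1 = ?a \<and> x2 = ?b \<and> y = \<xi> u1 \<otimes> \<xi> u2 then 1 else 0) else 0)"
    unfolding hmul3_13_23[OF as] by (intro sum.cong refl) (use as in \<open>auto simp: Rxi_pm 1 3\<close>)
  also have "\<dots> = ?L (u1 \<otimes> x1, u2 \<otimes> x2, v \<otimes> y)"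
    using as by (auto simp: hcomul_pm Rxi_pm 2)
  finally show "?L (u1 \<otimes> x1, u2 \<otimes> x2, v \<otimes> y) = ?R (u1 \<otimes> x1, u2 \<otimes> x2, v \<otimes> y)" ..
next
  fix k1 k2 k3 assume "k1 \<notin> carrier G \<or> k2 \<notin> carrier G \<or> k3 \<notin> carrier G"
  then show "?L (k1, k2, k3) = ?R (k1, k2, k3)"
    by (auto simp: hmul3_outside hcomul_outside Rxi_outside hcomul_zero)
qed

text \<open>Only \<open>p = inv (rm (\<xi> v2) u)\<close> contributes and moves the first leg to
  \<open>lp (\<xi> v2) u\<close>. The product rule for \<open>rm\<close> composes the labels, and
  \<open>lm_xi\<close> gives the condition on \<open>y1\<close>.\<close>

lemma Rxi_comul_right:
  "(\<lambda>(k1, k2, k3). hcomul G Gp Gm (\<lambda>g. Rxi G Gp Gm \<xi> (k1, g)) (k2, k3))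
    = hmul3 G Gp Gm (\<lambda>(k1, k2, k3). Rxi G Gp Gm \<xi> (k1, k3) * hunit Gp k2)
        (\<lambda>(k1, k2, k3). Rxi G Gp Gm \<xi> (k1, k2) * hunit Gp k3)" (is "?L = ?R")
proof (rule ext_pm3)
  fix u x v1 y1 v2 y2
  assume as: "u \<in> Gp" "x \<in> Gm" "v1 \<in> Gp" "y1 \<in> Gm" "v2 \<in> Gp" "y2 \<in> Gm"
  let ?p = "inv (rm (\<xi> v2) u)" and ?u = "lp (\<xi> v2) u"
  have 1: "\<xi> ?u = lm v2 (\<xi> u)"
    using as by (simp add: lm_xi(2)[OF eqv br])
  have 2: "inv (rm (\<xi> (v1 \<otimes> v2)) u) = ?p \<otimes> inv (rm (\<xi> v1) ?u)"
    using as by (simp add: lp_rm_mult_left inv_mult_group)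
  have 3: "inv ?p \<otimes> x = inv (rm (\<xi> v1) ?u) \<longleftrightarrow> x = ?p \<otimes> inv (rm (\<xi> v1) ?u)"
    using as by (intro inv_mult_eq_iff) simp_all
  have "?R (u \<otimes> x, v1 \<otimes> y1, v2 \<otimes> y2) = (\<Sum>p\<in>Gm. if p = ?p then
      (if y2 = \<xi> u \<and> x = ?p \<otimes> inv (rm (\<xi> v1) ?u) \<and> y1 = lm v2 (\<xi> u) then 1 else 0) else 0)"
    unfolding hmul3_13_12[OF as]
  proof (intro sum.cong refl)
    fix p assume p: "p \<in> Gm"
    show "Rxi G Gp Gm \<xi> (u \<otimes> p, v2 \<otimes> y2) * Rxi G Gp Gm \<xi> (rp u p \<otimes> (inv p \<otimes> x), v1 \<otimes> y1) =
      (if p = ?p then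
      (if y2 = \<xi> u \<and> x = ?p \<otimes> inv (rm (\<xi> v1) ?u) \<and> y1 = lm v2 (\<xi> u) then 1 else 0) else 0)"
    proof (cases "p = ?p")
      case True
      have "rp u p = ?u"
        using True as by (simp add: inv_rm)
      then show ?thesis
        using as p True 3 by (simp add: Rxi_pm 1 del: inv_inv)
    qed (use as p in \<open>simp add: Rxi_pm\<close>)
  qed
  also have "\<dots> = ?L (u \<otimes> x, v1 \<otimes> y1, v2 \<otimes> y2)"
    using as 2 by (auto simp: hcomul_pm Rxi_pm)
  finally show "?L (u \<otimes> x, v1 \<otimes> y1, v2 \<otimes> y2) = ?R (u \<otimes> x, v1 \<otimes> y1, v2 \<otimes> y2)" ..
next
  fix k1 k2 k3 assume "k1 \<notin> carrier G \<or> k2 \<notin> carrier G \<or> k3 \<notin> carrier G"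
  then show "?L (k1, k2, k3) = ?R (k1, k2, k3)"
    by (auto simp: hmul3_outside hcomul_outside Rxi_outside hcomul_zero)
qed

lemma Rxi_counit_left: "(\<Sum>g\<in>carrier G. hcounit G Gp Gm g * Rxi G Gp Gm \<xi> (g, h)) = hunit Gp h"
  unfolding sum_hcounit
proof (cases "h \<in> carrier G")
  case True
  then obtain v y where vy: "v \<in> Gp" "y \<in> Gm" "h = v \<otimes> y"
    by (metis factorization_pm)
  have "(\<Sum>x\<in>Gm. Rxi G Gp Gm \<xi> (x, h)) =
      (\<Sum>x\<in>Gm. if x = inv (\<xi> v) then (if y = \<one> then 1 else 0) else 0)"
    by (intro sum.cong refl) (use vy Rxi_pm[of \<one> _ v y] in auto)
  then show "(\<Sum>x\<in>Gm. Rxi G Gp Gm \<xi> (x, h)) = hunit Gp h"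
    using vy by (simp add: hunit_pm)
qed (simp add: Rxi_outside hunit_outside)

lemma Rxi_counit_right: "(\<Sum>h\<in>carrier G. hcounit G Gp Gm h * Rxi G Gp Gm \<xi> (g, h)) = hunit Gp g"
  unfolding sum_hcounit
proof (cases "g \<in> carrier G")
  case True
  then obtain u x where ux: "u \<in> Gp" "x \<in> Gm" "g = u \<otimes> x"
    by (metis factorization_pm)
  have "(\<Sum>y\<in>Gm. Rxi G Gp Gm \<xi> (g, y)) =
      (\<Sum>y\<in>Gm. if y = \<xi> u then (if x = \<one> then 1 else 0) else 0)"
    by (intro sum.cong refl) (use ux Rxi_pm[of u x \<one>] in auto)
  then show "(\<Sum>y\<in>Gm. Rxi G Gp Gm \<xi> (g, y)) = hunit Gp g"
    using ux by (simp add: hunit_pm)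
qed (simp add: Rxi_outside hunit_outside)

lemma triangular_Rxi: "triangular G Gp Gm (Rxi G Gp Gm \<xi>)"
proof -
  let ?R = "Rxi G Gp Gm \<xi>"
  \<comment> \<open>The flip is the witness for the inverse; multiplying
    \<open>Rxi_intertwines\<close> by it on the right gives the conjugation form.\<close>
  have "flip ?R \<in> H2 G"
    by (auto simp: H2_def Rxi_outside)
  moreover have "flip (hcomul G Gp Gm f) = hmul2 G Gp Gm (hmul2 G Gp Gm ?R (hcomul G Gp Gm f)) (flip ?R)" for f
  proof -
    have "flip (hcomul G Gp Gm f) \<in> H2 G"
      by (auto simp: H2_def hcomul_outside)
    then show ?thesis
      unfolding Rxi_intertwines[symmetric] hmul2_assoc Rxi_inverse by (simp add: hmul2_unit_right)
  qed
  ultimately show ?thesis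
    unfolding triangular_def quasitriangular_def
    using Rxi_H2 Rxi_inverse Rxi_inverse' Rxi_comul_left Rxi_comul_right Rxi_counit_left Rxi_counit_right
    by blast
qed

end

text \<open>Over \<open>(u, \<one>)\<close> the first label of \<open>Rxi\<close> is trivial and the
  second is \<open>\<xi> u\<close>, so the support alone recovers \<open>\<xi>\<close> on
  \<open>Gp\<close>.\<close>

lemma Rxi_determines_xi:
  assumes "u \<in> Gp" "y \<in> Gm"
  shows "Rxi G Gp Gm \<xi> (u, y) \<noteq> 0 \<longleftrightarrow> y = \<xi> u"
  using Rxi_pm[of u \<one> \<one> y] assms by simp

end

section \<open>Positive triangular structures come from homomorphisms\<close>

lemma positive_iff: "positive R \<longleftrightarrow> (\<forall>p. 0 \<le> R p)"
  by (auto simp: positive_def less_eq_complex_def)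

locale positive_triangular = factored_group G Gp Gm for G :: "'g monoid" (structure) and Gp Gm +
  fixes R :: "'g \<times> 'g \<Rightarrow> complex"
  assumes triangular_R: "triangular G Gp Gm R" and positive_R: "positive R"
begin

lemma R_H2: "R \<in> H2 G"
  using triangular_R by (simp add: triangular_def quasitriangular_def)

text \<open>The flip is multiplicative and fixes the unit, so applying it to the triangularity
  equation turns a left inverse into a two-sided one.\<close>

lemma R_flip_inverse: "hmul2 G Gp Gm (flip R) R = hunit2 Gp" "hmul2 G Gp Gm R (flip R) = hunit2 Gp"
proof -
  show *: "hmul2 G Gp Gm (flip R) R = hunit2 Gp"
    using triangular_R by (simp add: triangular_def)
  show "hmul2 G Gp Gm R (flip R) = hunit2 Gp"
    using hmul2_flip[of "flip R" R] by (simp add: * flip_hunit2 case_prod_eta)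
qed

lemma R_intertwines:
  assumes "f \<in> H1 G"
  shows "hmul2 G Gp Gm (flip (hcomul G Gp Gm f)) R = hmul2 G Gp Gm R (hcomul G Gp Gm f)"
proof -
  obtain S where S: "hmul2 G Gp Gm S R = hunit2 Gp"
      "flip (hcomul G Gp Gm f) = hmul2 G Gp Gm (hmul2 G Gp Gm R (hcomul G Gp Gm f)) S"
    using triangular_R assms unfolding triangular_def quasitriangular_def by blast
  have "hmul2 G Gp Gm R (hcomul G Gp Gm f) \<in> H2 G"
    by (auto simp: H2_def hmul2_outside)
  then show ?thesis
    unfolding S(2) hmul2_assoc[of _ S] S(1) by (rule hmul2_unit_right)
qed

lemma R_comul_left:
  assumes "u1 \<in> Gp" "x1 \<in> Gm" "u2 \<in> Gp" "x2 \<in> Gm" "v \<in> Gp" "y \<in> Gm"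
  shows "(if x1 = lm u2 x2 then R (u1 \<otimes> u2 \<otimes> x2, v \<otimes> y) else 0) =
    (\<Sum>r\<in>Gm. R (u1 \<otimes> x1, v \<otimes> r) * R (u2 \<otimes> x2, rp v r \<otimes> (inv r \<otimes> y)))"
proof -
  have "(\<lambda>(k1, k2, k3). hcomul G Gp Gm (\<lambda>g. R (g, k3)) (k1, k2))
      = hmul3 G Gp Gm (\<lambda>(k1, k2, k3). R (k1, k3) * hunit Gp k2)
          (\<lambda>(k1, k2, k3). hunit Gp k1 * R (k2, k3))"
    using triangular_R unfolding triangular_def quasitriangular_def by blast
  from fun_cong[OF this, of "(u1 \<otimes> x1, u2 \<otimes> x2, v \<otimes> y)"] show ?thesis
    unfolding hmul3_13_23[OF assms] prod.case using assms by (simp add: hcomul_pm)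
qed

lemma R_comul_right:
  assumes "u \<in> Gp" "x \<in> Gm" "v1 \<in> Gp" "y1 \<in> Gm" "v2 \<in> Gp" "y2 \<in> Gm"
  shows "(if y1 = lm v2 y2 then R (u \<otimes> x, v1 \<otimes> v2 \<otimes> y2) else 0) =
    (\<Sum>p\<in>Gm. R (u \<otimes> p, v2 \<otimes> y2) * R (rp u p \<otimes> (inv p \<otimes> x), v1 \<otimes> y1))"
proof -
  have "(\<lambda>(k1, k2, k3). hcomul G Gp Gm (\<lambda>g. R (k1, g)) (k2, k3))
      = hmul3 G Gp Gm (\<lambda>(k1, k2, k3). R (k1, k3) * hunit Gp k2)
          (\<lambda>(k1, k2, k3). R (k1, k2) * hunit Gp k3)"
    using triangular_R unfolding triangular_def quasitriangular_def by blast
  from fun_cong[OF this, of "(u \<otimes> x, v1 \<otimes> y1, v2 \<otimes> y2)"] show ?thesis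
    unfolding hmul3_13_12[OF assms] prod.case using assms by (simp add: hcomul_pm)
qed

lemma R_monomial:
  assumes u: "u \<in> Gp" and v: "v \<in> Gp"
  shows "\<exists>r\<in>Gm \<times> Gm. \<forall>x\<in>Gm. \<forall>y\<in>Gm. R (u \<otimes> x, v \<otimes> y) \<noteq> 0 \<longleftrightarrow> (x, y) = r"
proof -
  have "\<exists>r\<in>carrier K. \<forall>x\<in>carrier K. coords R (u, v) x \<noteq> 0 \<longleftrightarrow> x = r"
  proof (rule conv2.nonneg_invertible_monomial[where F = "coords (flip R)"])
    show "0 \<le> coords R p r" "0 \<le> coords (flip R) p r" for p r
      using positive_R by (auto simp: positive_iff coords_def)
    show "conv2.conv (coords R) (coords (flip R)) p r = (if r = \<one>\<^bsub>K\<^esub> then 1 else 0)"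
      "conv2.conv (coords (flip R)) (coords R) p r = (if r = \<one>\<^bsub>K\<^esub> then 1 else 0)"
      if "p \<in> Gp \<times> Gp" "r \<in> carrier K" for p r
      using that
      by (auto simp: coords_hmul2[symmetric] R_flip_inverse hunit2_pm hunit2_one split: if_splits)
  qed (use u v in auto)
  then show ?thesis
    by (fastforce simp: coords_def)
qed

section \<open>Labels and coefficients of a positive triangular structure\<close>

definition a where "a u v = fst (SOME r. r \<in> Gm \<times> Gm \<and>
    (\<forall>x\<in>Gm. \<forall>y\<in>Gm. R (u \<otimes> x, v \<otimes> y) \<noteq> 0 \<longleftrightarrow> (x, y) = r))"
definition b where "b u v = snd (SOME r. r \<in> Gm \<times> Gm \<and>
    (\<forall>x\<in>Gm. \<forall>y\<in>Gm. R (u \<otimes> x, v \<otimes> y) \<noteq> 0 \<longleftrightarrow> (x, y) = r))"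
definition c where "c u v = R (u \<otimes> a u v, v \<otimes> b u v)"

text \<open>The choice terms in \<open>a\<close> and \<open>b\<close> use the same predicate, so
  they are the components of one and the same pair.\<close>

lemma ab_aux:
  assumes "u \<in> Gp" "v \<in> Gp"
  shows "(a u v, b u v) \<in> Gm \<times> Gm \<and>
    (\<forall>x\<in>Gm. \<forall>y\<in>Gm. R (u \<otimes> x, v \<otimes> y) \<noteq> 0 \<longleftrightarrow> (x, y) = (a u v, b u v))"
  unfolding a_def b_def prod.collapse
  by (rule someI_ex) (use R_monomial[OF assms] in blast)

lemma ab_closed [simp]:
  "u \<in> Gp \<Longrightarrow> v \<in> Gp \<Longrightarrow> a u v \<in> Gm" "u \<in> Gp \<Longrightarrow> v \<in> Gp \<Longrightarrow> b u v \<in> Gm"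
  using ab_aux by auto

lemma R_eq_0_iff:
  assumes "u \<in> Gp" "v \<in> Gp" "x \<in> Gm" "y \<in> Gm"
  shows "R (u \<otimes> x, v \<otimes> y) = 0 \<longleftrightarrow> \<not> (x = a u v \<and> y = b u v)"
  using ab_aux[OF assms(1,2)] assms(3,4) by auto

lemma R_pm:
  assumes "u \<in> Gp" "x \<in> Gm" "v \<in> Gp" "y \<in> Gm"
  shows "R (u \<otimes> x, v \<otimes> y) = (if x = a u v \<and> y = b u v then c u v else 0)"
  using R_eq_0_iff[OF assms(1,3,2,4)] by (auto simp: c_def)

lemma c_nonzero: "u \<in> Gp \<Longrightarrow> v \<in> Gp \<Longrightarrow> c u v \<noteq> 0"
  by (simp add: c_def R_eq_0_iff)

text \<open>The coproduct equation is evaluated where its right side has exactly one nonzero term.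
  The left side is then nonzero too, which forces the coproduct condition and identifies the labels
  of \<open>R\<close> over \<open>(u1 \<otimes> u2, v)\<close>.\<close>

lemma comul_left_relations:
  assumes u: "u1 \<in> Gp" "u2 \<in> Gp" and v: "v \<in> Gp"
  defines "w \<equiv> rp v (b u1 v)"
  shows "lm u2 (a u2 w) = a u1 v" "a (u1 \<otimes> u2) v = a u2 w"
    "b (u1 \<otimes> u2) v = b u1 v \<otimes> b u2 w" "c (u1 \<otimes> u2) v = c u1 v * c u2 w"
proof -
  have w: "w \<in> Gp"
    using u v by (simp add: w_def)
  let ?y = "b u1 v \<otimes> b u2 w"
  have "(\<Sum>r\<in>Gm. R (u1 \<otimes> a u1 v, v \<otimes> r) * R (u2 \<otimes> a u2 w, rp v r \<otimes> (inv r \<otimes> ?y)))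
      = (\<Sum>r\<in>Gm. if r = b u1 v then c u1 v * c u2 w else 0)"
    by (intro sum.cong refl) (use u v w in \<open>auto simp: R_pm w_def[symmetric] inv_cancel_left\<close>)
  then have eq: "(if a u1 v = lm u2 (a u2 w) then R (u1 \<otimes> u2 \<otimes> a u2 w, v \<otimes> ?y) else 0)
      = c u1 v * c u2 w"
    using u v w by (simp add: R_comul_left)
  have nz: "c u1 v * c u2 w \<noteq> 0"
    using u v w by (simp add: c_nonzero)
  with eq show "lm u2 (a u2 w) = a u1 v"
    by (metis (full_types))
  with eq have R: "R (u1 \<otimes> u2 \<otimes> a u2 w, v \<otimes> ?y) = c u1 v * c u2 w"
    by simp
  with nz have *: "a u2 w = a (u1 \<otimes> u2) v \<and> ?y = b (u1 \<otimes> u2) v"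
    using u v w R_eq_0_iff[of "u1 \<otimes> u2" v "a u2 w" ?y] by simp
  then show "a (u1 \<otimes> u2) v = a u2 w" "b (u1 \<otimes> u2) v = ?y"
    by simp_all
  then show "c (u1 \<otimes> u2) v = c u1 v * c u2 w"
    using R by (simp add: c_def)
qed

text \<open>The same evaluation at a single nonzero term, now for the coproduct in the second
  leg.\<close>

lemma comul_right_relations:
  assumes u: "u \<in> Gp" and v: "v1 \<in> Gp" "v2 \<in> Gp"
  defines "w \<equiv> rp u (a u v2)"
  shows "b w v1 = lm v2 (b u v2)" "b u (v1 \<otimes> v2) = b u v2"
    "a u (v1 \<otimes> v2) = a u v2 \<otimes> a w v1"
proof -
  have w: "w \<in> Gp"
    using u v by (simp add: w_def)
  let ?x = "a u v2 \<otimes> a w v1"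
  have "(\<Sum>p\<in>Gm. R (u \<otimes> p, v2 \<otimes> b u v2) * R (rp u p \<otimes> (inv p \<otimes> ?x), v1 \<otimes> b w v1))
      = (\<Sum>p\<in>Gm. if p = a u v2 then c u v2 * c w v1 else 0)"
    by (intro sum.cong refl) (use u v w in \<open>auto simp: R_pm w_def[symmetric] inv_cancel_left\<close>)
  then have eq: "(if b w v1 = lm v2 (b u v2) then R (u \<otimes> ?x, v1 \<otimes> v2 \<otimes> b u v2) else 0)
      = c u v2 * c w v1"
    using u v w by (simp add: R_comul_right)
  have nz: "c u v2 * c w v1 \<noteq> 0"
    using u v w by (simp add: c_nonzero)
  with eq show "b w v1 = lm v2 (b u v2)"
    by (metis (full_types))
  with eq nz have "R (u \<otimes> ?x, v1 \<otimes> v2 \<otimes> b u v2) \<noteq> 0"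
    by simp
  then show "b u (v1 \<otimes> v2) = b u v2" "a u (v1 \<otimes> v2) = ?x"
    using u v w R_eq_0_iff[of u "v1 \<otimes> v2" ?x "b u v2"] by simp_all
qed

definition xi where "xi u = b u \<one>"

text \<open>In \<open>b u (v1 \<otimes> v2) = b u v2\<close> the choice \<open>v2 = \<one>\<close>
  removes the dependence on \<open>v1\<close>.\<close>

lemma b_eq_xi:
  assumes "u \<in> Gp" "v \<in> Gp"
  shows "b u v = xi u"
  using comul_right_relations(2)[of u v \<one>] assms by (simp add: xi_def)

lemma xi_mem [simp]: "u \<in> Gp \<Longrightarrow> xi u \<in> Gm"
  by (simp add: xi_def)

lemma xi_morphism: "u \<in> Gp \<Longrightarrow> v \<in> Gp \<Longrightarrow> xi (u \<otimes> v) = xi u \<otimes> xi v"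
  using comul_left_relations(3)[of u v \<one>] by (simp add: b_eq_xi)

lemma xi_hom: "xi \<in> hom (G\<lparr>carrier := Gp\<rparr>) (G\<lparr>carrier := Gm\<rparr>)"
  by (auto simp: hom_def xi_morphism)

sublocale factored_hom G Gp Gm xi
  by unfold_locales (rule xi_hom)

text \<open>Both factors of \<open>(\<tau>R)R = 1\<close> are monomial, so their arrows must be inverse to each other.\<close>
lemma a_one_left:
  assumes u: "u \<in> Gp"
  shows "a \<one> u = inv (xi u)"
proof -
  have "hmul2 G Gp Gm (flip R) R (u \<otimes> \<one>, \<one> \<otimes> \<one>) =
      flip R (u \<otimes> xi \<one>, \<one> \<otimes> a \<one> u) *
      R (rp u (xi \<one>) \<otimes> (inv (xi \<one>) \<otimes> \<one>), rp \<one> (a \<one> u) \<otimes> (inv (a \<one> u) \<otimes> \<one>))"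
  proof (rule hmul2_monomial)
    fix p q assume "p \<in> Gm" "q \<in> Gm" "flip R (u \<otimes> p, \<one> \<otimes> q) \<noteq> 0"
    then show "p = xi \<one> \<and> q = a \<one> u"
      using u R_eq_0_iff[of \<one> u q p] by (simp add: b_eq_xi)
  qed (use u in simp_all)
  then have "R (u \<otimes> \<one>, \<one> \<otimes> inv (a \<one> u)) \<noteq> 0"
    using u R_flip_inverse(1) hunit2_one[of u \<one>] by auto
  then have "inv (a \<one> u) = xi u"
    using u R_eq_0_iff[of u \<one> \<one> "inv (a \<one> u)"] by (simp add: b_eq_xi)
  then show ?thesis
    using u by (metis ab_closed(1) Gm_closed(1) Gp_closed(2) inv_inv)
qed

text \<open>Splitting \<open>u\<close> as \<open>u \<otimes> \<one>\<close> and as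
  \<open>\<one> \<otimes> u\<close> in the first coproduct relation reduces \<open>a u v\<close> to
  values of \<open>a \<one>\<close> in two ways.\<close>

lemma a_eq:
  assumes u: "u \<in> Gp" and v: "v \<in> Gp"
  shows "a u v = inv (xi (rp v (xi u)))" "a u v = inv (rm (xi v) u)"
proof -
  show "a u v = inv (xi (rp v (xi u)))"
    using comul_left_relations(2)[of u \<one> v] u v by (simp add: b_eq_xi a_one_left)
  have "lm u (a u v) = a \<one> v"
    using comul_left_relations(1)[of \<one> u v] u v by (simp add: b_eq_xi)
  then have "a u v = lm (inv u) (inv (xi v))"
    using u v by (metis lm_inv_cancel(2) ab_closed(1) a_one_left)
  then show "a u v = inv (rm (xi v) u)"
    using u v by (simp add: inv_rm(1))
qed

text \<open>The relation is tested on the basis element \<open>v \<otimes> u \<otimes> x\<close>,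
  whose flipped coproduct has a single term over \<open>(u, v)\<close>. At the chosen coordinates
  the left side is a nonzero coefficient, so all conditions on the right side must hold.\<close>

lemma intertwiner_relations:
  assumes u: "u \<in> Gp" and v: "v \<in> Gp" and x: "x \<in> Gm"
  shows "v \<otimes> u = lp (xi v) u \<otimes> rp v (xi u)" "xi u \<otimes> x = lm u x \<otimes> xi (rp u x)"
    "c u v = c (rp u x) (rp v (lm u x))"
proof -
  let ?f = "\<lambda>g. if g = v \<otimes> u \<otimes> x then 1 else 0 :: complex"
  let ?q = "lm u x" and ?u = "rp u x"
  let ?v = "rp v ?q" and ?w = "rp v (xi u)" and ?p = "a u v"
  \<comment> \<open>The labels of the composite of that coproduct term with the arrow of
    \<open>R\<close> starting at its end point \<open>(?u, ?v)\<close>.\<close>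
  let ?z1 = "x \<otimes> a ?u ?v" and ?z2 = "?q \<otimes> xi ?u"
  have mem: "?q \<in> Gm" "?u \<in> Gp" "?v \<in> Gp" "?w \<in> Gp" "?p \<in> Gm" "?z1 \<in> Gm" "?z2 \<in> Gm"
    "rp u ?p \<in> Gp"
    using u v x by simp_all
  have "?f \<in> H1 G"
    using u v x by (simp add: H1_def)
  then have "hmul2 G Gp Gm (flip (hcomul G Gp Gm ?f)) R (u \<otimes> ?z1, v \<otimes> ?z2) =
      hmul2 G Gp Gm R (hcomul G Gp Gm ?f) (u \<otimes> ?z1, v \<otimes> ?z2)"
    by (simp add: R_intertwines)
  also have "\<dots> = R (u \<otimes> ?p, v \<otimes> xi u) *
      hcomul G Gp Gm ?f (rp u ?p \<otimes> (inv ?p \<otimes> ?z1), ?w \<otimes> (inv (xi u) \<otimes> ?z2))"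
  proof (rule hmul2_monomial)
    fix p q assume "p \<in> Gm" "q \<in> Gm" "R (u \<otimes> p, v \<otimes> q) \<noteq> 0"
    then show "p = ?p \<and> q = xi u"
      using u v R_eq_0_iff[of u v p q] by (simp add: b_eq_xi)
  qed (use u v mem in simp_all)
  also have "R (u \<otimes> ?p, v \<otimes> xi u) = c u v"
    using u v by (simp add: R_pm b_eq_xi)
  also have "hcomul G Gp Gm ?f (rp u ?p \<otimes> (inv ?p \<otimes> ?z1), ?w \<otimes> (inv (xi u) \<otimes> ?z2)) =
      (if inv ?p \<otimes> ?z1 = lm ?w (inv (xi u) \<otimes> ?z2) then
        if rp u ?p \<otimes> ?w \<otimes> (inv (xi u) \<otimes> ?z2) = v \<otimes> u \<otimes> x then 1 else 0 else 0)"
    using u mem by (intro hcomul_pm) simp_all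
  also have "hmul2 G Gp Gm (flip (hcomul G Gp Gm ?f)) R (u \<otimes> ?z1, v \<otimes> ?z2) =
      flip (hcomul G Gp Gm ?f) (u \<otimes> x, v \<otimes> ?q) * R (?u \<otimes> (inv x \<otimes> ?z1), ?v \<otimes> (inv ?q \<otimes> ?z2))"
  proof (rule hmul2_monomial)
    fix p q assume "p \<in> Gm" "q \<in> Gm" "flip (hcomul G Gp Gm ?f) (u \<otimes> p, v \<otimes> q) \<noteq> 0"
    then show "p = x \<and> q = ?q"
      using u v x by (auto simp: hcomul_pm split: if_splits)
  qed (use u v x mem in simp_all)
  also have "\<dots> = c ?u ?v"
    using u v x mem by (simp add: hcomul_pm R_pm b_eq_xi inv_cancel_left)
  finally have eq: "c ?u ?v = c u v * (if inv ?p \<otimes> ?z1 = lm ?w (inv (xi u) \<otimes> ?z2) then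
        if rp u ?p \<otimes> ?w \<otimes> (inv (xi u) \<otimes> ?z2) = v \<otimes> u \<otimes> x then 1 else 0 else 0)" .
  have "c ?u ?v \<noteq> 0"
    using mem by (simp add: c_nonzero)
  with eq have *: "rp u ?p \<otimes> ?w \<otimes> (inv (xi u) \<otimes> ?z2) = v \<otimes> u \<otimes> x"
    and c: "c ?u ?v = c u v"
    by (auto split: if_splits)
  from * have **: "rp u ?p \<otimes> ?w = v \<otimes> u \<and> inv (xi u) \<otimes> ?z2 = x"
    using u v x mem by (subst (asm) pm_eq_iff) simp_all
  then show "v \<otimes> u = lp (xi v) u \<otimes> rp v (xi u)"
    using u v by (simp add: a_eq(2) inv_rm(2))
  show "xi u \<otimes> x = lm u x \<otimes> xi (rp u x)"
    using ** u x mem by (simp add: inv_mult_eq_iff)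
  show "c u v = c (rp u x) (rp v (lm u x))"
    by (rule c[symmetric])
qed

lemma R_braided_commutative: braided_commutative
  unfolding braided_commutative_def
  by (intro ballI) (rule intertwiner_relations(1)[OF _ _ Gm_closed(2)])

lemma R_equivariant: equivariant
  unfolding equivariant_def
proof (intro ballI)
  fix u x assume "u \<in> Gp" "x \<in> Gm"
  then show "xi (lp x u) \<otimes> rm x u = x \<otimes> xi u"
    using intertwiner_relations(2)[of "lp x u" \<one> "rm x u"] by simp
qed

text \<open>By the invariance of \<open>c\<close> under \<open>G\<^sub>-\<close>, the cocycle relation for \<open>c\<close> becomes multiplicativity
  in the first argument with respect to the group structure of \<open>A\<^sub>\<xi>\<close>.\<close>
lemma c_mult:
  assumes u: "u1 \<in> Gp" "u2 \<in> Gp" and v: "v \<in> Gp"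
  shows "c (u1 \<otimes> u2) v = c u1 v * c (lp (xi u1) u2) v"
proof -
  \<comment> \<open>This label satisfies \<open>lm u2 ?x = inv (xi u1)\<close> and
    \<open>rp u2 ?x = lp (xi u1) u2\<close>, so it moves \<open>?w\<close> back to \<open>v\<close>
    and turns \<open>u2\<close> into the twisted factor.\<close>
  let ?x = "inv (rm (xi u1) u2)" and ?w = "rp v (xi u1)"
  have "lm u2 ?x = inv (xi u1)"
    using u by (simp add: inv_rm(1)[symmetric])
  then have "c u2 ?w = c (lp (xi u1) u2) v"
    using intertwiner_relations(3)[of u2 ?w ?x] u v by (simp add: inv_rm(2))
  then show ?thesis
    using comul_left_relations(4)[of u1 u2 v] u v by (simp add: b_eq_xi)
qed

text \<open>Translation by \<open>u\<close> and the left action of \<open>xi u\<close> both permute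
  \<open>Gp\<close>, so the product of \<open>c_mult\<close> over all \<open>w\<close> gives
  \<open>c u v ^ card Gp = 1\<close>; a non-negative real root of unity is one.\<close>

lemma c_eq_one:
  assumes u: "u \<in> Gp" and v: "v \<in> Gp"
  shows "c u v = 1"
proof -
  have "(\<Prod>w\<in>Gp. c w v) = (\<Prod>w\<in>Gp. c (u \<otimes> w) v)"
    by (rule prod.reindex_bij_witness[where i = "\<lambda>w. u \<otimes> w" and j = "\<lambda>w. inv u \<otimes> w"])
      (use u in \<open>auto simp: inv_cancel_left\<close>)
  also have "\<dots> = (\<Prod>w\<in>Gp. c u v * c (lp (xi u) w) v)"
    using u v by (intro prod.cong refl) (simp add: c_mult)
  also have "\<dots> = c u v ^ card Gp * (\<Prod>w\<in>Gp. c (lp (xi u) w) v)"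
    by (simp add: prod.distrib)
  also have "(\<Prod>w\<in>Gp. c (lp (xi u) w) v) = (\<Prod>w\<in>Gp. c w v)"
    by (rule prod.reindex_bij_witness[where j = "\<lambda>w. lp (xi u) w" and i = "\<lambda>w. lp (inv (xi u)) w"])
      (use u in auto)
  finally have "c u v ^ card Gp = 1"
    using v by (simp add: c_nonzero)
  moreover obtain r where r: "c u v = complex_of_real r" "0 \<le> r"
    using positive_R by (metis c_def complex_is_Real_iff of_real_Re positive_def)
  ultimately have "r ^ card Gp = 1"
    by (metis of_real_eq_1_iff of_real_power)
  moreover have "card Gp > 0"
    by (metis Gp_closed(2) card_gt_0_iff empty_iff finite_Gp)
  ultimately have "r = 1"
    using r(2) by (metis power_eq_1_iff abs_of_nonneg real_norm_def neq0_conv)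
  then show ?thesis
    using r by simp
qed

lemma R_eq_Rxi: "R = Rxi G Gp Gm xi"
proof (rule ext_pm2)
  fix u x v y assume "u \<in> Gp" "x \<in> Gm" "v \<in> Gp" "y \<in> Gm"
  then show "R (u \<otimes> x, v \<otimes> y) = Rxi G Gp Gm xi (u \<otimes> x, v \<otimes> y)"
    by (simp add: R_pm Rxi_pm c_eq_one b_eq_xi a_eq(2))
qed (use R_H2 in \<open>auto simp: H2_def Rxi_outside\<close>)

end

section \<open>Pairs and one-cocycles\<close>

context factored_hom
begin

lemma pt_zeta_q: "u \<in> Gp \<Longrightarrow> pt_zeta G Gp \<xi> (q u) = \<xi> u"
proof -
  assume u: "u \<in> Gp"
  have "(THE w. w \<in> Gp \<and> q u = w \<otimes> \<xi> (inv w)) = u"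
    by (rule the_equality) (use u in \<open>auto simp: q_def\<close>)
  then show ?thesis
    by (simp add: pt_zeta_def)
qed

lemma tp_Gp_eq:
  "tp_Gp (G\<lparr>carrier := Axi G Gp \<xi>\<rparr>) (pt_zeta G Gp \<xi>) = (\<lambda>u. (q u, \<xi> u)) ` Gp"
  by (auto simp: tp_Gp_def Axi_eq pt_zeta_q)

lemma q_mult_xi: "u \<in> Gp \<Longrightarrow> q u \<otimes> \<xi> u = u"
  by (simp add: q_def m_assoc)

context
  assumes normal_A: "Axi G Gp \<xi> \<lhd> G"
begin

lemma act_by_aut_A: "act_by_aut (G\<lparr>carrier := Gm\<rparr>) (G\<lparr>carrier := Axi G Gp \<xi>\<rparr>) (pt_act G)"
proof -
  have sub: "a \<in> carrier G" if "a \<in> Axi G Gp \<xi>" for a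
    by (rule subgroup.mem_carrier[OF normal_imp_subgroup[OF normal_A] that])
  have conj: "x \<otimes> a \<otimes> inv x \<in> Axi G Gp \<xi>" if "x \<in> carrier G" "a \<in> Axi G Gp \<xi>" for x a
    using that normal_A by (simp add: normal_inv_iff)
  have conj': "x \<otimes> (a \<otimes> inv x) \<in> Axi G Gp \<xi>" if "x \<in> Gm" "a \<in> Axi G Gp \<xi>" for x a
    using conj[of x a] that sub by (simp add: m_assoc)
  have bij: "bij_betw (pt_act G x) (Axi G Gp \<xi>) (Axi G Gp \<xi>)" if x: "x \<in> Gm" for x
  proof (rule bij_betwI)
    show "pt_act G x \<in> Axi G Gp \<xi> \<rightarrow> Axi G Gp \<xi>" "pt_act G (inv x) \<in> Axi G Gp \<xi> \<rightarrow> Axi G Gp \<xi>"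
      using conj[of x] conj[of "inv x"] x by (auto simp: pt_act_def)
  qed (use x sub in \<open>auto simp: pt_act_def m_assoc inv_cancel_left\<close>)
  show ?thesis
    unfolding act_by_aut_def using bij
    by (auto simp: hom_def conj' sub pt_act_def m_assoc inv_mult_group inv_cancel_left)
qed

text \<open>Twisting \<open>q v\<close> by \<open>\<xi> u\<close> makes its product with
  \<open>q u\<close> equal to \<open>q (u \<otimes> v)\<close>, so the cocycle identity is the
  multiplicativity of \<open>\<xi>\<close>.\<close>

lemma one_cycle_A:
  "one_cycle (G\<lparr>carrier := Gm\<rparr>) (G\<lparr>carrier := Axi G Gp \<xi>\<rparr>) (pt_act G) (pt_zeta G Gp \<xi>)"
proof -
  have "q u \<otimes> pt_act G (\<xi> u) (q v) = q (u \<otimes> v)" if "u \<in> Gp" "v \<in> Gp" for u v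
    using that by (simp add: pt_act_def q_def m_assoc inv_mult_group inv_cancel_left)
  then show ?thesis
    by (auto simp: one_cycle_def Axi_eq pt_zeta_q)
qed

lemma sdprod_iso:
  "(\<lambda>(a, x). a \<otimes> x) \<in> iso (sdprod (G\<lparr>carrier := Axi G Gp \<xi>\<rparr>) (G\<lparr>carrier := Gm\<rparr>) (pt_act G)) G"
proof (rule isoI)
  show "(\<lambda>(a, x). a \<otimes> x) \<in> hom (sdprod (G\<lparr>carrier := Axi G Gp \<xi>\<rparr>) (G\<lparr>carrier := Gm\<rparr>) (pt_act G)) G"
    by (auto simp: hom_def sdprod_def Axi_eq pt_act_def m_assoc inv_cancel_left)
  \<comment> \<open>Since \<open>q u\<close> differs from \<open>u\<close> by a right factor in
    \<open>Gm\<close>, unique factorization along \<open>Axi\<close> and \<open>Gm\<close> reduces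
    to that along \<open>Gp\<close> and \<open>Gm\<close>.\<close>
  have eq: "q u \<otimes> x = u \<otimes> (inv (\<xi> u) \<otimes> x)" if "u \<in> Gp" "x \<in> Gm" for u x
    using that by (simp add: q_def m_assoc)
  have "bij_betw (\<lambda>(a, x). a \<otimes> x) (Axi G Gp \<xi> \<times> Gm) (carrier G)"
    unfolding bij_betw_def
  proof
    show "inj_on (\<lambda>(a, x). a \<otimes> x) (Axi G Gp \<xi> \<times> Gm)"
      by (rule inj_onI) (auto simp: Axi_eq eq)
    show "(\<lambda>(a, x). a \<otimes> x) ` (Axi G Gp \<xi> \<times> Gm) = carrier G"
    proof
      show "carrier G \<subseteq> (\<lambda>(a, x). a \<otimes> x) ` (Axi G Gp \<xi> \<times> Gm)"
      proof
        fix g assume "g \<in> carrier G"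
        then obtain u x where ux: "u \<in> Gp" "x \<in> Gm" "g = u \<otimes> x"
          by (rule factorization_pm)
        then have "g = q u \<otimes> (\<xi> u \<otimes> x)"
          by (simp add: eq inv_cancel_left)
        then show "g \<in> (\<lambda>(a, x). a \<otimes> x) ` (Axi G Gp \<xi> \<times> Gm)"
          using ux by (auto simp: Axi_eq)
      qed
    qed (auto simp: Axi_eq)
  qed
  then show "bij_betw (\<lambda>(a, x). a \<otimes> x)
      (carrier (sdprod (G\<lparr>carrier := Axi G Gp \<xi>\<rparr>) (G\<lparr>carrier := Gm\<rparr>) (pt_act G))) (carrier G)"
    by (simp add: sdprod_def)
qed

end

end

section \<open>From a triple to a pair\<close>

locale cocycle_triple = Y: group Y + A: comm_group A
  for Y :: "'x monoid" (structure) and A :: "'a monoid" (structure) +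
  fixes \<phi> :: "'x \<Rightarrow> 'a \<Rightarrow> 'a" and \<zeta> :: "'a \<Rightarrow> 'x"
  assumes finite_Y: "finite (carrier Y)" and finite_A: "finite (carrier A)"
    and action: "act_by_aut Y A \<phi>" and cocycle: "one_cycle Y A \<phi> \<zeta>"
begin

abbreviation S where "S \<equiv> sdprod A Y \<phi>"

lemma phi_simps [simp]:
  "x \<in> carrier Y \<Longrightarrow> a \<in> carrier A \<Longrightarrow> \<phi> x a \<in> carrier A"
  "x \<in> carrier Y \<Longrightarrow> a \<in> carrier A \<Longrightarrow> b \<in> carrier A \<Longrightarrow>
    \<phi> x (a \<otimes>\<^bsub>A\<^esub> b) = \<phi> x a \<otimes>\<^bsub>A\<^esub> \<phi> x b"
  "a \<in> carrier A \<Longrightarrow> \<phi> \<one>\<^bsub>Y\<^esub> a = a"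
  "x \<in> carrier Y \<Longrightarrow> y \<in> carrier Y \<Longrightarrow> a \<in> carrier A \<Longrightarrow> \<phi> (x \<otimes>\<^bsub>Y\<^esub> y) a = \<phi> x (\<phi> y a)"
  using action by (auto simp: act_by_aut_def hom_def)

lemma phi_one [simp]: "x \<in> carrier Y \<Longrightarrow> \<phi> x \<one>\<^bsub>A\<^esub> = \<one>\<^bsub>A\<^esub>"
  using phi_simps(2)[of x "\<one>\<^bsub>A\<^esub>" "\<one>\<^bsub>A\<^esub>"] A.r_cancel_one[of "\<phi> x \<one>\<^bsub>A\<^esub>" "\<phi> x \<one>\<^bsub>A\<^esub>"]
  by (metis A.one_closed A.r_one phi_simps(1))

lemma phi_inv_cancel [simp]:
  "x \<in> carrier Y \<Longrightarrow> a \<in> carrier A \<Longrightarrow> \<phi> x (\<phi> (inv\<^bsub>Y\<^esub> x) a) = a"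
  "x \<in> carrier Y \<Longrightarrow> a \<in> carrier A \<Longrightarrow> \<phi> (inv\<^bsub>Y\<^esub> x) (\<phi> x a) = a"
  by (simp_all add: phi_simps(4)[symmetric] del: phi_simps(4))

lemma zeta_closed [simp]: "a \<in> carrier A \<Longrightarrow> \<zeta> a \<in> carrier Y"
  using cocycle by (auto simp: one_cycle_def)

lemma zeta_mult:
  "a \<in> carrier A \<Longrightarrow> b \<in> carrier A \<Longrightarrow> \<zeta> (a \<otimes>\<^bsub>A\<^esub> \<phi> (\<zeta> a) b) = \<zeta> a \<otimes>\<^bsub>Y\<^esub> \<zeta> b"
  using cocycle unfolding one_cycle_def by metis

lemma zeta_one [simp]: "\<zeta> \<one>\<^bsub>A\<^esub> = \<one>\<^bsub>Y\<^esub>"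
  using zeta_mult[of "\<one>\<^bsub>A\<^esub>" "\<one>\<^bsub>A\<^esub>"] by simp

lemma S_simps [simp]:
  "carrier S = carrier A \<times> carrier Y"
  "(a, x) \<otimes>\<^bsub>S\<^esub> (b, y) = (a \<otimes>\<^bsub>A\<^esub> \<phi> x b, x \<otimes>\<^bsub>Y\<^esub> y)"
  "\<one>\<^bsub>S\<^esub> = (\<one>\<^bsub>A\<^esub>, \<one>\<^bsub>Y\<^esub>)"
  by (simp_all add: sdprod_def)

lemma group_S: "group S"
proof (rule groupI)
  fix p assume "p \<in> carrier S"
  then obtain a x where ax: "p = (a, x)" "a \<in> carrier A" "x \<in> carrier Y" by auto
  then have "(\<phi> (inv\<^bsub>Y\<^esub> x) (inv\<^bsub>A\<^esub> a), inv\<^bsub>Y\<^esub> x) \<otimes>\<^bsub>S\<^esub> p = \<one>\<^bsub>S\<^esub>"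
    by (simp add: phi_simps(2)[symmetric] del: phi_simps(2))
  moreover have "(\<phi> (inv\<^bsub>Y\<^esub> x) (inv\<^bsub>A\<^esub> a), inv\<^bsub>Y\<^esub> x) \<in> carrier S"
    using ax by simp
  ultimately show "\<exists>r\<in>carrier S. r \<otimes>\<^bsub>S\<^esub> p = \<one>\<^bsub>S\<^esub>" by blast
qed (auto simp: A.m_assoc Y.m_assoc)

sublocale S: group S
  by (rule group_S)

lemma S_inv:
  assumes "a \<in> carrier A" "x \<in> carrier Y"
  shows "inv\<^bsub>S\<^esub> (a, x) = (\<phi> (inv\<^bsub>Y\<^esub> x) (inv\<^bsub>A\<^esub> a), inv\<^bsub>Y\<^esub> x)"
  by (rule S.inv_equality) (use assms in \<open>simp_all add: phi_simps(2)[symmetric] del: phi_simps(2)\<close>)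

text \<open>The set is the graph of \<open>\<zeta>\<close>, and the cocycle identity says that the
  graph is closed under the semidirect product.\<close>

lemma subgroup_tp_Gp: "subgroup (tp_Gp A \<zeta>) S"
proof (rule S.subgroupI)
  fix p assume "p \<in> tp_Gp A \<zeta>"
  then obtain a where a: "p = (a, \<zeta> a)" "a \<in> carrier A"
    by (auto simp: tp_Gp_def)
  \<comment> \<open>The solution \<open>b\<close> of
    \<open>a \<otimes> \<phi> (\<zeta> a) b = \<one>\<close>; the cocycle identity then makes
    \<open>\<zeta> b\<close> the inverse of \<open>\<zeta> a\<close>.\<close>
  let ?b = "\<phi> (inv\<^bsub>Y\<^esub> (\<zeta> a)) (inv\<^bsub>A\<^esub> a)"
  have "\<zeta> a \<otimes>\<^bsub>Y\<^esub> \<zeta> ?b = \<one>\<^bsub>Y\<^esub>"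
    using a by (simp add: zeta_mult[symmetric])
  then have "inv\<^bsub>Y\<^esub> (\<zeta> a) = \<zeta> ?b"
    using a by (metis A.inv_closed Y.inv_closed Y.inv_equality Y.inv_inv phi_simps(1) zeta_closed)
  then have "inv\<^bsub>S\<^esub> p = (?b, \<zeta> ?b)"
    using a by (simp add: S_inv)
  then show "inv\<^bsub>S\<^esub> p \<in> tp_Gp A \<zeta>"
    using a by (auto simp: tp_Gp_def)
next
  fix p r assume "p \<in> tp_Gp A \<zeta>" "r \<in> tp_Gp A \<zeta>"
  then show "p \<otimes>\<^bsub>S\<^esub> r \<in> tp_Gp A \<zeta>"
    by (auto simp: tp_Gp_def zeta_mult)
qed (auto simp: tp_Gp_def)

lemma subgroup_tp_Gm: "subgroup (tp_Gm A Y) S"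
  by (rule S.subgroupI) (auto simp: tp_Gm_def S_inv)

text \<open>The \<open>A\<close> component of an element already determines its factor
  \<open>(a, \<zeta> a)\<close> in the graph; dividing it out leaves an element of
  \<open>tp_Gm\<close>.\<close>

lemma ufact_S: "ufact S (tp_Gp A \<zeta>) (tp_Gm A Y)"
  unfolding ufact_def
proof (intro conjI ballI subgroup_tp_Gp subgroup_tp_Gm)
  fix g assume "g \<in> carrier S"
  then obtain a x where ax: "g = (a, x)" "a \<in> carrier A" "x \<in> carrier Y" by auto
  let ?p = "((a, \<zeta> a), (\<one>\<^bsub>A\<^esub>, inv\<^bsub>Y\<^esub> (\<zeta> a) \<otimes>\<^bsub>Y\<^esub> x))"
  show "\<exists>!p. p \<in> tp_Gp A \<zeta> \<times> tp_Gm A Y \<and> g = fst p \<otimes>\<^bsub>S\<^esub> snd p"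
  proof (rule ex1I[of _ ?p])
    show "?p \<in> tp_Gp A \<zeta> \<times> tp_Gm A Y \<and> g = fst ?p \<otimes>\<^bsub>S\<^esub> snd ?p"
      using ax by (auto simp: tp_Gp_def tp_Gm_def Y.inv_cancel_left)
  next
    fix p assume "p \<in> tp_Gp A \<zeta> \<times> tp_Gm A Y \<and> g = fst p \<otimes>\<^bsub>S\<^esub> snd p"
    then show "p = ?p"
      using ax by (auto simp: tp_Gp_def tp_Gm_def Y.inv_cancel_left)
  qed
qed

lemma tp_xi_hom: "tp_xi A \<in> hom (S\<lparr>carrier := tp_Gp A \<zeta>\<rparr>) (S\<lparr>carrier := tp_Gm A Y\<rparr>)"
  by (auto simp: hom_def tp_xi_def tp_Gp_def tp_Gm_def)

lemma tp_q:
  assumes "a \<in> carrier A"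
  shows "(a, \<zeta> a) \<otimes>\<^bsub>S\<^esub> tp_xi A (inv\<^bsub>S\<^esub> (a, \<zeta> a)) = (a, \<one>\<^bsub>Y\<^esub>)"
  using assms by (simp add: S_inv tp_xi_def)

lemma Axi_S: "Axi S (tp_Gp A \<zeta>) (tp_xi A) = {(a, \<one>\<^bsub>Y\<^esub>) | a. a \<in> carrier A}"
proof -
  have "Axi S (tp_Gp A \<zeta>) (tp_xi A) = (\<lambda>a. (a, \<zeta> a) \<otimes>\<^bsub>S\<^esub> tp_xi A (inv\<^bsub>S\<^esub> (a, \<zeta> a))) ` carrier A"
    by (auto simp: Axi_def tp_Gp_def simp del: S_simps)
  also have "\<dots> = (\<lambda>a. (a, \<one>\<^bsub>Y\<^esub>)) ` carrier A"
    by (rule image_cong[OF refl]) (rule tp_q)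
  finally show ?thesis by auto
qed

lemma normal_Axi_S: "Axi S (tp_Gp A \<zeta>) (tp_xi A) \<lhd> S"
  unfolding Axi_S S.normal_inv_iff
proof
  show "subgroup {(a, \<one>\<^bsub>Y\<^esub>) | a. a \<in> carrier A} S"
    by (rule S.subgroupI) (auto simp: S_inv)
qed (auto simp: S_inv)

lemma iso_A: "(\<lambda>a. (a, \<one>\<^bsub>Y\<^esub>)) \<in> iso A (S\<lparr>carrier := Axi S (tp_Gp A \<zeta>) (tp_xi A)\<rparr>)"
  by (rule isoI) (auto simp: Axi_S hom_def bij_betw_def inj_on_def)

lemma comm_group_Axi_S: "comm_group (S\<lparr>carrier := Axi S (tp_Gp A \<zeta>) (tp_xi A)\<rparr>)"
  by (rule group.group_comm_groupI)
    (auto simp: Axi_S A.m_comm intro: subgroup.subgroup_is_group normal_Axi_S[unfolded Axi_S]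
      normal_imp_subgroup group_S)

lemma iso_Y: "(\<lambda>x. (\<one>\<^bsub>A\<^esub>, x)) \<in> iso Y (S\<lparr>carrier := tp_Gm A Y\<rparr>)"
  by (rule isoI) (auto simp: tp_Gm_def hom_def bij_betw_def inj_on_def)

lemma pt_act_S:
  "x \<in> carrier Y \<Longrightarrow> a \<in> carrier A \<Longrightarrow> pt_act S (\<one>\<^bsub>A\<^esub>, x) (a, \<one>\<^bsub>Y\<^esub>) = (\<phi> x a, \<one>\<^bsub>Y\<^esub>)"
  by (simp add: pt_act_def S_inv)

lemma pt_zeta_S:
  assumes a: "a \<in> carrier A"
  shows "pt_zeta S (tp_Gp A \<zeta>) (tp_xi A) (a, \<one>\<^bsub>Y\<^esub>) = (\<one>\<^bsub>A\<^esub>, \<zeta> a)"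
proof -
  have "(THE u. u \<in> tp_Gp A \<zeta> \<and> (a, \<one>\<^bsub>Y\<^esub>) = u \<otimes>\<^bsub>S\<^esub> tp_xi A (inv\<^bsub>S\<^esub> u)) = (a, \<zeta> a)"
  proof (rule the_equality)
    fix u assume "u \<in> tp_Gp A \<zeta> \<and> (a, \<one>\<^bsub>Y\<^esub>) = u \<otimes>\<^bsub>S\<^esub> tp_xi A (inv\<^bsub>S\<^esub> u)"
    then show "u = (a, \<zeta> a)"
      using tp_q by (auto simp: tp_Gp_def simp del: S_simps)
  qed (use a tp_q in \<open>auto simp: tp_Gp_def simp del: S_simps\<close>)
  then show ?thesis
    by (simp add: pt_zeta_def tp_xi_def)
qed

end

theorem theorem4:
  shows
  "(\<forall>(G :: 'g monoid) Gp Gm. group G \<and> finite (carrier G) \<and> ufact G Gp Gm \<longrightarrow>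
      \<comment> \<open>(i)\<close>
      (\<forall>R. (triangular G Gp Gm R \<and> positive R) \<longleftrightarrow>
           (\<exists>\<xi>. \<xi> \<in> hom (G\<lparr>carrier := Gp\<rparr>) (G\<lparr>carrier := Gm\<rparr>) \<and>
                Axi G Gp \<xi> \<lhd> G \<and> comm_group (G\<lparr>carrier := Axi G Gp \<xi>\<rparr>) \<and>
                R = Rxi G Gp Gm \<xi>)) \<and>
      (\<forall>\<xi>1 \<xi>2. \<xi>1 \<in> hom (G\<lparr>carrier := Gp\<rparr>) (G\<lparr>carrier := Gm\<rparr>) \<and>
                Axi G Gp \<xi>1 \<lhd> G \<and> comm_group (G\<lparr>carrier := Axi G Gp \<xi>1\<rparr>) \<and>
                \<xi>2 \<in> hom (G\<lparr>carrier := Gp\<rparr>) (G\<lparr>carrier := Gm\<rparr>) \<and>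
                Axi G Gp \<xi>2 \<lhd> G \<and> comm_group (G\<lparr>carrier := Axi G Gp \<xi>2\<rparr>) \<and>
                Rxi G Gp Gm \<xi>1 = Rxi G Gp Gm \<xi>2 \<longrightarrow> (\<forall>u\<in>Gp. \<xi>1 u = \<xi>2 u)) \<and>
      \<comment> \<open>(ii)\<close>
      (\<forall>\<xi>. \<xi> \<in> hom (G\<lparr>carrier := Gp\<rparr>) (G\<lparr>carrier := Gm\<rparr>) \<longrightarrow>
           ((Axi G Gp \<xi> \<lhd> G \<and> comm_group (G\<lparr>carrier := Axi G Gp \<xi>\<rparr>)) \<longleftrightarrow>
            (\<forall>u\<in>Gp. \<forall>v\<in>Gp. u \<otimes>\<^bsub>G\<^esub> v = lact_p G Gp Gm (\<xi> u) v \<otimes>\<^bsub>G\<^esub> ract_p G Gp Gm u (\<xi> v)) \<and>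
            (\<forall>u\<in>Gp. \<forall>x\<in>Gm. \<xi> (lact_p G Gp Gm x u) \<otimes>\<^bsub>G\<^esub> ract_m G Gp Gm x u = x \<otimes>\<^bsub>G\<^esub> \<xi> u))) \<and>
      \<comment> \<open>(iii), pair \<rightarrow> triple, and back to the pair up to the identification (a,x) \<mapsto> ax\<close>
      (\<forall>\<xi>. \<xi> \<in> hom (G\<lparr>carrier := Gp\<rparr>) (G\<lparr>carrier := Gm\<rparr>) \<and>
           Axi G Gp \<xi> \<lhd> G \<and> comm_group (G\<lparr>carrier := Axi G Gp \<xi>\<rparr>) \<longrightarrow>
        (let A = G\<lparr>carrier := Axi G Gp \<xi>\<rparr>; Gm' = G\<lparr>carrier := Gm\<rparr>;
             \<zeta> = pt_zeta G Gp \<xi>; S = sdprod A Gm' (pt_act G);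
             f = (\<lambda>(a, x). a \<otimes>\<^bsub>G\<^esub> x) in
          (\<forall>u\<in>Gp. \<forall>v\<in>Gp. u \<otimes>\<^bsub>G\<^esub> \<xi> (inv\<^bsub>G\<^esub> u) = v \<otimes>\<^bsub>G\<^esub> \<xi> (inv\<^bsub>G\<^esub> v) \<longrightarrow> \<xi> u = \<xi> v) \<and>
          (\<forall>u\<in>Gp. \<zeta> (u \<otimes>\<^bsub>G\<^esub> \<xi> (inv\<^bsub>G\<^esub> u)) = \<xi> u) \<and>
          group Gm' \<and> finite (carrier Gm') \<and> comm_group A \<and> finite (carrier A) \<and>
          act_by_aut Gm' A (pt_act G) \<and> one_cycle Gm' A (pt_act G) \<zeta> \<and>
          f \<in> iso S G \<and> f ` tp_Gp A \<zeta> = Gp \<and> f ` tp_Gm A Gm' = Gm \<and>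
          (\<forall>p\<in>tp_Gp A \<zeta>. \<xi> (f p) = f (tp_xi A p)))))
   \<and>
   \<comment> \<open>(iii), triple \<rightarrow> pair, and back to the triple up to a \<mapsto> (a,1), x \<mapsto> (1,x)\<close>
   (\<forall>(Gm :: 'x monoid) (A :: 'a monoid) \<phi> \<zeta>.
      group Gm \<and> finite (carrier Gm) \<and> comm_group A \<and> finite (carrier A) \<and>
      act_by_aut Gm A \<phi> \<and> one_cycle Gm A \<phi> \<zeta> \<longrightarrow>
      (let S = sdprod A Gm \<phi>; Gp' = tp_Gp A \<zeta>; Gm' = tp_Gm A Gm; \<xi>' = tp_xi A in
        group S \<and> finite (carrier S) \<and> ufact S Gp' Gm' \<and>
        \<xi>' \<in> hom (S\<lparr>carrier := Gp'\<rparr>) (S\<lparr>carrier := Gm'\<rparr>) \<and>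
        Axi S Gp' \<xi>' \<lhd> S \<and> comm_group (S\<lparr>carrier := Axi S Gp' \<xi>'\<rparr>) \<and>
        Axi S Gp' \<xi>' = {(a, \<one>\<^bsub>Gm\<^esub>) | a. a \<in> carrier A} \<and>
        (\<lambda>a. (a, \<one>\<^bsub>Gm\<^esub>)) \<in> iso A (S\<lparr>carrier := Axi S Gp' \<xi>'\<rparr>) \<and>
        (\<lambda>x. (\<one>\<^bsub>A\<^esub>, x)) \<in> iso Gm (S\<lparr>carrier := Gm'\<rparr>) \<and>
        (\<forall>x\<in>carrier Gm. \<forall>a\<in>carrier A.
           pt_act S (\<one>\<^bsub>A\<^esub>, x) (a, \<one>\<^bsub>Gm\<^esub>) = (\<phi> x a, \<one>\<^bsub>Gm\<^esub>)) \<and>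
        (\<forall>a\<in>carrier A. pt_zeta S Gp' \<xi>' (a, \<one>\<^bsub>Gm\<^esub>) = (\<one>\<^bsub>A\<^esub>, \<zeta> a))))"
proof (intro conjI allI impI)
  fix G :: "'g monoid" and Gp Gm
  assume as: "group G \<and> finite (carrier G) \<and> ufact G Gp Gm"
  then interpret factored_group G Gp Gm
    by (simp add: factored_group.intro factored_group_axioms.intro)
  have hom: "factored_hom G Gp Gm \<xi>"
    if "\<xi> \<in> hom (G\<lparr>carrier := Gp\<rparr>) (G\<lparr>carrier := Gm\<rparr>)" for \<xi>
    by unfold_locales (rule that)
  show "triangular G Gp Gm R \<and> positive R \<longleftrightarrow>
      (\<exists>\<xi>. \<xi> \<in> hom (G\<lparr>carrier := Gp\<rparr>) (G\<lparr>carrier := Gm\<rparr>) \<and>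
        Axi G Gp \<xi> \<lhd> G \<and> comm_group (G\<lparr>carrier := Axi G Gp \<xi>\<rparr>) \<and>
        R = Rxi G Gp Gm \<xi>)" for R
  proof
    assume "triangular G Gp Gm R \<and> positive R"
    then interpret positive_triangular G Gp Gm R
      by unfold_locales simp_all
    show "\<exists>\<xi>. \<xi> \<in> hom (G\<lparr>carrier := Gp\<rparr>) (G\<lparr>carrier := Gm\<rparr>) \<and>
        Axi G Gp \<xi> \<lhd> G \<and> comm_group (G\<lparr>carrier := Axi G Gp \<xi>\<rparr>) \<and>
        R = Rxi G Gp Gm \<xi>"
      using xi_hom abelian_normal_iff R_equivariant R_braided_commutative R_eq_Rxi by blast
  next
    assume "\<exists>\<xi>. \<xi> \<in> hom (G\<lparr>carrier := Gp\<rparr>) (G\<lparr>carrier := Gm\<rparr>) \<and>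
        Axi G Gp \<xi> \<lhd> G \<and> comm_group (G\<lparr>carrier := Axi G Gp \<xi>\<rparr>) \<and>
        R = Rxi G Gp Gm \<xi>"
    then show "triangular G Gp Gm R \<and> positive R"
      using factored_hom.triangular_Rxi factored_hom.positive_Rxi
        factored_hom.abelian_normal_iff hom by metis
  qed
  show "\<forall>u\<in>Gp. \<xi>1 u = \<xi>2 u"
    if "\<xi>1 \<in> hom (G\<lparr>carrier := Gp\<rparr>) (G\<lparr>carrier := Gm\<rparr>) \<and>
        Axi G Gp \<xi>1 \<lhd> G \<and> comm_group (G\<lparr>carrier := Axi G Gp \<xi>1\<rparr>) \<and>
        \<xi>2 \<in> hom (G\<lparr>carrier := Gp\<rparr>) (G\<lparr>carrier := Gm\<rparr>) \<and>
        Axi G Gp \<xi>2 \<lhd> G \<and> comm_group (G\<lparr>carrier := Axi G Gp \<xi>2\<rparr>) \<and>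
        Rxi G Gp Gm \<xi>1 = Rxi G Gp Gm \<xi>2" for \<xi>1 \<xi>2
  proof
    fix u assume u: "u \<in> Gp"
    have xi: "factored_hom G Gp Gm \<xi>1" "factored_hom G Gp Gm \<xi>2"
      using that hom by blast+
    have mem: "\<xi>1 u \<in> Gm"
      using factored_hom.xi_closed[OF xi(1) u] .
    show "\<xi>1 u = \<xi>2 u"
      using factored_hom.Rxi_determines_xi[OF xi(1) u mem]
        factored_hom.Rxi_determines_xi[OF xi(2) u mem] that by simp
  qed
  show "Axi G Gp \<xi> \<lhd> G \<and> comm_group (G\<lparr>carrier := Axi G Gp \<xi>\<rparr>) \<longleftrightarrow>
      (\<forall>u\<in>Gp. \<forall>v\<in>Gp. u \<otimes>\<^bsub>G\<^esub> v =
        lact_p G Gp Gm (\<xi> u) v \<otimes>\<^bsub>G\<^esub> ract_p G Gp Gm u (\<xi> v)) \<and>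
      (\<forall>u\<in>Gp. \<forall>x\<in>Gm. \<xi> (lact_p G Gp Gm x u) \<otimes>\<^bsub>G\<^esub> ract_m G Gp Gm x u = x \<otimes>\<^bsub>G\<^esub> \<xi> u)"
    if "\<xi> \<in> hom (G\<lparr>carrier := Gp\<rparr>) (G\<lparr>carrier := Gm\<rparr>)" for \<xi>
  proof -
    interpret factored_hom G Gp Gm \<xi>
      by (rule hom[OF that])
    show ?thesis
      by (rule abelian_normal_iff[unfolded braided_commutative_def equivariant_def])
  qed
  show "let A = G\<lparr>carrier := Axi G Gp \<xi>\<rparr>; Gm' = G\<lparr>carrier := Gm\<rparr>;
             \<zeta> = pt_zeta G Gp \<xi>; S = sdprod A Gm' (pt_act G);
             f = (\<lambda>(a, x). a \<otimes>\<^bsub>G\<^esub> x) in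
          (\<forall>u\<in>Gp. \<forall>v\<in>Gp. u \<otimes>\<^bsub>G\<^esub> \<xi> (inv\<^bsub>G\<^esub> u) = v \<otimes>\<^bsub>G\<^esub> \<xi> (inv\<^bsub>G\<^esub> v) \<longrightarrow> \<xi> u = \<xi> v) \<and>
          (\<forall>u\<in>Gp. \<zeta> (u \<otimes>\<^bsub>G\<^esub> \<xi> (inv\<^bsub>G\<^esub> u)) = \<xi> u) \<and>
          group Gm' \<and> finite (carrier Gm') \<and> comm_group A \<and> finite (carrier A) \<and>
          act_by_aut Gm' A (pt_act G) \<and> one_cycle Gm' A (pt_act G) \<zeta> \<and>
          f \<in> iso S G \<and> f ` tp_Gp A \<zeta> = Gp \<and> f ` tp_Gm A Gm' = Gm \<and>
          (\<forall>p\<in>tp_Gp A \<zeta>. \<xi> (f p) = f (tp_xi A p))"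
    if *: "\<xi> \<in> hom (G\<lparr>carrier := Gp\<rparr>) (G\<lparr>carrier := Gm\<rparr>) \<and>
      Axi G Gp \<xi> \<lhd> G \<and> comm_group (G\<lparr>carrier := Axi G Gp \<xi>\<rparr>)" for \<xi>
  proof -
    interpret factored_hom G Gp Gm \<xi>
      by (rule hom) (use * in blast)
    have q: "u \<otimes>\<^bsub>G\<^esub> \<xi> (inv\<^bsub>G\<^esub> u) = q u" if "u \<in> Gp" for u
      using that by (simp add: q_def)
    have N: "Axi G Gp \<xi> \<lhd> G" and C: "comm_group (G\<lparr>carrier := Axi G Gp \<xi>\<rparr>)"
      using * by blast+
    \<comment> \<open>By \<open>q_mult_xi\<close> the identification sends
      \<open>(q u, \<xi> u)\<close> back to \<open>u\<close>, which recovers \<open>Gp\<close> and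
      turns the projection into \<open>\<xi>\<close>.\<close>
    have "(\<lambda>(a, x). a \<otimes>\<^bsub>G\<^esub> x) ` (\<lambda>u. (q u, \<xi> u)) ` Gp = Gp"
      by (simp add: image_image q_mult_xi)
    moreover have "(\<lambda>(a, x). a \<otimes>\<^bsub>G\<^esub> x) ` tp_Gm (G\<lparr>carrier := Axi G Gp \<xi>\<rparr>) (G\<lparr>carrier := Gm\<rparr>) = Gm"
      by (force simp: tp_Gm_def)
    ultimately show ?thesis
      unfolding Let_def tp_Gp_eq
      using C act_by_aut_A[OF N] one_cycle_A[OF N] sdprod_iso[OF N] group_Gm
      by (auto simp: q pt_zeta_q pt_zeta_q[unfolded q_def] Axi_eq tp_xi_def q_mult_xi)
  qed
next
  fix Gm :: "'x monoid" and A :: "'a monoid" and \<phi> \<zeta>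
  assume as: "group Gm \<and> finite (carrier Gm) \<and> comm_group A \<and> finite (carrier A) \<and>
    act_by_aut Gm A \<phi> \<and> one_cycle Gm A \<phi> \<zeta>"
  then interpret cocycle_triple Gm A \<phi> \<zeta>
    by (simp add: cocycle_triple.intro cocycle_triple_axioms.intro)
  have "finite (carrier S)"
    using finite_A finite_Y by simp
  then show "let S = sdprod A Gm \<phi>; Gp' = tp_Gp A \<zeta>; Gm' = tp_Gm A Gm; \<xi>' = tp_xi A in
        group S \<and> finite (carrier S) \<and> ufact S Gp' Gm' \<and>
        \<xi>' \<in> hom (S\<lparr>carrier := Gp'\<rparr>) (S\<lparr>carrier := Gm'\<rparr>) \<and>
        Axi S Gp' \<xi>' \<lhd> S \<and> comm_group (S\<lparr>carrier := Axi S Gp' \<xi>'\<rparr>) \<and>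
        Axi S Gp' \<xi>' = {(a, \<one>\<^bsub>Gm\<^esub>) | a. a \<in> carrier A} \<and>
        (\<lambda>a. (a, \<one>\<^bsub>Gm\<^esub>)) \<in> iso A (S\<lparr>carrier := Axi S Gp' \<xi>'\<rparr>) \<and>
        (\<lambda>x. (\<one>\<^bsub>A\<^esub>, x)) \<in> iso Gm (S\<lparr>carrier := Gm'\<rparr>) \<and>
        (\<forall>x\<in>carrier Gm. \<forall>a\<in>carrier A.
           pt_act S (\<one>\<^bsub>A\<^esub>, x) (a, \<one>\<^bsub>Gm\<^esub>) = (\<phi> x a, \<one>\<^bsub>Gm\<^esub>)) \<and>
        (\<forall>a\<in>carrier A. pt_zeta S Gp' \<xi>' (a, \<one>\<^bsub>Gm\<^esub>) = (\<one>\<^bsub>A\<^esub>, \<zeta> a))"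
    unfolding Let_def
    by (intro conjI ballI group_S ufact_S tp_xi_hom normal_Axi_S comm_group_Axi_S Axi_S
        iso_A iso_Y pt_act_S pt_zeta_S)
qed


end
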